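(* Let $\mathfrak{g}$ be a finite-dimensional Lie algebra over a field $\mathbb{F}$ of characteristic zero, let $\mu\in\mathbb{N}^\ell$, and define \[ A=\mathbb{F}[t_1,\dotsc,t_\ell]/\operatorname{Span}_{\mathbb{F}}\{t^\omega\mid\omega\in\mathbb{N}^\ell,\ \omega\not\le\mu\}. \] \begin{enumerate} \item We have $\chi(\mathfrak{g}\otimes A)=\chi(\mathfrak{g})\dim A$. \item A linear form $F=\sum_{\omega\le\mu}f_\omega\otimes\epsilon^\omega$ (with $f_\omega\in\mathfrak{g}^*$) on $\mathfrak{g}\otimes A$ is regular if and only if $f_\mu$ is a regular linear form on $\mathfrak{g}$. \end{enumerate}
   Context: Tensor products are over $\mathbb{F}$; $\mathbb{N}=\{0,1,2,\dotsc\}$; $\ell\in\mathbb{N}$; $\mathbb{N}^\ell$ is ordered componentwise; $t^\omega=t_1^{\omega_1}\dotsm t_\ell^{\omega_\ell}$. Let $\tau^\omega$ be the image of $t^\omega$ in $A$; $\{\tau^\omega\mid\omega\in\mathbb{N}^\ell,\ \omega\le\mu\}$ is a basis of $A$, and $\{\epsilon^\omega\}_{\omega\le\mu}$ denotes the dual basis of $A^*$. We identify $(\mathfrak{g}\otimes A)^*$ with $\mathfrak{g}^*\otimes A^*$. The bracket on $\mathfrak{g}\otimes A$ is $[x\otimes a,y\otimes b]=[x,y]\otimes ab$. For a finite-dimensional Lie algebra $\mathfrak{a}$ and $f\in\mathfrak{a}^*$, let $\mathfrak{a}^f=\{x\in\mathfrak{a}\mid f([\mathfrak{a},x])=0\}$.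 The index of $\mathfrak{a}$ is $\chi(\mathfrak{a})=\inf\{\dim\mathfrak{a}^f\mid f\in\mathfrak{a}^*\}$, and $f$ is called regular if $\dim\mathfrak{a}^f=\chi(\mathfrak{a})$. *)

theory Defs
  imports "Jordan_Normal_Form.VS_Connect" "HOL-Algebra.QuotRing"
    "HOL-Library.Poly_Mapping"
begin

section \<open>Lie algebras and their index\<close>

text \<open>A module record also carries a ring multiplication and a unit; for a Lie algebra they are
  unconstrained and play no role.\<close>

record ('k, 'g) lie_alg = "('k, 'g) module" +
  bracket :: "'g \<Rightarrow> 'g \<Rightarrow> 'g"

locale lie_algebra = vectorspace K L
  for K :: "('k, 'm) ring_scheme" and L :: "('k, 'g, 'n) lie_alg_scheme" +
  assumes bracket_closed:
      "\<And>x y. x \<in> carrier L \<Longrightarrow> y \<in> carrier L \<Longrightarrow> bracket L x y \<in> carrier L"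
    and bracket_add_left:
      "\<And>x x' y. x \<in> carrier L \<Longrightarrow> x' \<in> carrier L \<Longrightarrow> y \<in> carrier L \<Longrightarrow>
        bracket L (x \<oplus>\<^bsub>L\<^esub> x') y = bracket L x y \<oplus>\<^bsub>L\<^esub> bracket L x' y"
    and bracket_add_right:
      "\<And>x y y'. x \<in> carrier L \<Longrightarrow> y \<in> carrier L \<Longrightarrow> y' \<in> carrier L \<Longrightarrow>
        bracket L x (y \<oplus>\<^bsub>L\<^esub> y') = bracket L x y \<oplus>\<^bsub>L\<^esub> bracket L x y'"
    and bracket_smult_left:
      "\<And>c x y. c \<in> carrier K \<Longrightarrow> x \<in> carrier L \<Longrightarrow> y \<in> carrier L \<Longrightarrow>
        bracket L (c \<odot>\<^bsub>L\<^esub> x) y = c \<odot>\<^bsub>L\<^esub> bracket L x y"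
    and bracket_smult_right:
      "\<And>c x y. c \<in> carrier K \<Longrightarrow> x \<in> carrier L \<Longrightarrow> y \<in> carrier L \<Longrightarrow>
        bracket L x (c \<odot>\<^bsub>L\<^esub> y) = c \<odot>\<^bsub>L\<^esub> bracket L x y"
    and bracket_self:
      "\<And>x. x \<in> carrier L \<Longrightarrow> bracket L x x = \<zero>\<^bsub>L\<^esub>"
    and jacobi:
      "\<And>x y z. x \<in> carrier L \<Longrightarrow> y \<in> carrier L \<Longrightarrow> z \<in> carrier L \<Longrightarrow>
        bracket L x (bracket L y z) \<oplus>\<^bsub>L\<^esub> bracket L y (bracket L z x)
          \<oplus>\<^bsub>L\<^esub> bracket L z (bracket L x y) = \<zero>\<^bsub>L\<^esub>"

definition scalar_module :: "('k, 'm) ring_scheme \<Rightarrow> ('k, 'k) module" where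
  "scalar_module K = \<lparr>carrier = carrier K, mult = mult K, one = one K, zero = zero K,
     add = add K, smult = mult K\<rparr>"

text \<open>The values of a linear form outside the carrier of \<open>V\<close> are irrelevant and unconstrained.\<close>

definition linear_forms :: "('k, 'm) ring_scheme \<Rightarrow> ('k, 'v, 'n) module_scheme \<Rightarrow> ('v \<Rightarrow> 'k) set" where
  "linear_forms K V = LinearCombinations.module_hom K V (scalar_module K)"

definition form_stabilizer ::
    "('k, 'm) ring_scheme \<Rightarrow> ('k, 'g, 'n) lie_alg_scheme \<Rightarrow> ('g \<Rightarrow> 'k) \<Rightarrow> 'g set" where
  "form_stabilizer K L f = {x \<in> carrier L. \<forall>y \<in> carrier L. f (bracket L y x) = \<zero>\<^bsub>K\<^esub>}"

definition stabilizer_dim ::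
    "('k, 'm) ring_scheme \<Rightarrow> ('k, 'g, 'n) lie_alg_scheme \<Rightarrow> ('g \<Rightarrow> 'k) \<Rightarrow> nat" where
  "stabilizer_dim K L f = vectorspace.dim K (L\<lparr>carrier := form_stabilizer K L f\<rparr>)"

definition lie_index :: "('k, 'm) ring_scheme \<Rightarrow> ('k, 'g, 'n) lie_alg_scheme \<Rightarrow> nat" where
  "lie_index K L = Inf {stabilizer_dim K L f | f. f \<in> linear_forms K L}"

definition regular_form ::
    "('k, 'm) ring_scheme \<Rightarrow> ('k, 'g, 'n) lie_alg_scheme \<Rightarrow> ('g \<Rightarrow> 'k) \<Rightarrow> bool" where
  "regular_form K L f \<longleftrightarrow> f \<in> linear_forms K L \<and> stabilizer_dim K L f = lie_index K L"


section \<open>Dual bases\<close>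

text \<open>The member with index \<open>i\<close> of the basis of the dual space that is dual to the basis
  \<open>(b j)\<^sub>j\<close>, \<open>j \<in> I\<close>, of \<open>V\<close>; extensionality makes it unique as a function.\<close>

definition dual_basis_form ::
    "('k, 'm) ring_scheme \<Rightarrow> ('k, 'v, 'n) module_scheme \<Rightarrow> 'i set \<Rightarrow> ('i \<Rightarrow> 'v) \<Rightarrow> 'i \<Rightarrow> 'v \<Rightarrow> 'k" where
  "dual_basis_form K V I b i =
     (THE e. e \<in> linear_forms K V \<and> e \<in> extensional (carrier V) \<and>
        (\<forall>j \<in> I. e (b j) = (if j = i then \<one>\<^bsub>K\<^esub> else \<zero>\<^bsub>K\<^esub>)))"


section \<open>Quotients\<close>

text \<open>The quotient ring \<^term>\<open>M Quot N\<close> with the induced scalar multiplication. For a module whose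
  ring multiplication is meaningless, only the module structure of the result is meaningful.\<close>

definition quotient_module ::
    "('k, 'v, 'n) module_scheme \<Rightarrow> 'v set \<Rightarrow> ('k, 'v set) module" where
  "quotient_module M N =
     \<lparr>carrier = carrier (M Quot N), mult = mult (M Quot N), one = one (M Quot N),
      zero = zero (M Quot N), add = add (M Quot N),
      smult = (\<lambda>c X. \<Union>x\<in>X. N +>\<^bsub>M\<^esub> (c \<odot>\<^bsub>M\<^esub> x))\<rparr>"


section \<open>The truncated polynomial algebra\<close>

text \<open>Exponent vectors in $\mathbb{N}^\ell$ are finitely supported functions on the naturals that
  vanish outside \<open>{..<l}\<close>. They are compared by \<open>exp_le\<close>: the order that the library
  puts on finitely supported functions is lexicographic rather than componentwise.\<close>

definition exponents :: "nat \<Rightarrow> (nat \<Rightarrow>\<^sub>0 nat) set" where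
  "exponents l = {\<omega>. Poly_Mapping.keys \<omega> \<subseteq> {..<l}}"

definition exp_le :: "(nat \<Rightarrow>\<^sub>0 nat) \<Rightarrow> (nat \<Rightarrow>\<^sub>0 nat) \<Rightarrow> bool" where
  "exp_le \<omega> \<mu> \<longleftrightarrow> (\<forall>i. Poly_Mapping.lookup \<omega> i \<le> Poly_Mapping.lookup \<mu> i)"

definition exponents_le :: "nat \<Rightarrow> (nat \<Rightarrow>\<^sub>0 nat) \<Rightarrow> (nat \<Rightarrow>\<^sub>0 nat) set" where
  "exponents_le l \<mu> = {\<omega> \<in> exponents l. exp_le \<omega> \<mu>}"

type_synonym 'k mpoly = "(nat \<Rightarrow>\<^sub>0 nat) \<Rightarrow>\<^sub>0 'k"

definition poly_algebra :: "nat \<Rightarrow> ('k::field, 'k mpoly) module" where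
  "poly_algebra l =
     \<lparr>carrier = {p. Poly_Mapping.keys p \<subseteq> exponents l}, mult = (*), one = 1, zero = 0,
      add = (+), smult = (\<lambda>c. Poly_Mapping.map ((*) c))\<rparr>"

definition monomial :: "(nat \<Rightarrow>\<^sub>0 nat) \<Rightarrow> 'k::field mpoly" where
  "monomial \<omega> = Poly_Mapping.single \<omega> 1"

definition truncation_ideal :: "nat \<Rightarrow> (nat \<Rightarrow>\<^sub>0 nat) \<Rightarrow> 'k::field mpoly set" where
  "truncation_ideal l \<mu> =
     LinearCombinations.module.span class_ring (poly_algebra l)
       (monomial ` {\<omega> \<in> exponents l. \<not> exp_le \<omega> \<mu>})"

definition truncated_algebra ::
    "nat \<Rightarrow> (nat \<Rightarrow>\<^sub>0 nat) \<Rightarrow> ('k::field, 'k mpoly set) module" where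
  "truncated_algebra l \<mu> = quotient_module (poly_algebra l) (truncation_ideal l \<mu>)"

definition tau :: "nat \<Rightarrow> (nat \<Rightarrow>\<^sub>0 nat) \<Rightarrow> (nat \<Rightarrow>\<^sub>0 nat) \<Rightarrow> 'k::field mpoly set" where
  "tau l \<mu> \<omega> = truncation_ideal l \<mu> +>\<^bsub>poly_algebra l\<^esub> monomial \<omega>"

definition eps :: "nat \<Rightarrow> (nat \<Rightarrow>\<^sub>0 nat) \<Rightarrow> (nat \<Rightarrow>\<^sub>0 nat) \<Rightarrow> 'k::field mpoly set \<Rightarrow> 'k" where
  "eps l \<mu> \<omega> =
     dual_basis_form class_ring (truncated_algebra l \<mu>) (exponents_le l \<mu>) (tau l \<mu>) \<omega>"


section \<open>Tensor products\<close>

definition free_module :: "'s set \<Rightarrow> ('k::field, 's \<Rightarrow>\<^sub>0 'k) module" where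
  "free_module S =
     \<lparr>carrier = {p. Poly_Mapping.keys p \<subseteq> S}, mult = undefined, one = undefined, zero = 0,
      add = (+), smult = (\<lambda>c. Poly_Mapping.map ((*) c))\<rparr>"

definition tensor_relations ::
    "('k::field, 'v, 'm) module_scheme \<Rightarrow> ('k, 'w, 'n) module_scheme \<Rightarrow> ('v \<times> 'w \<Rightarrow>\<^sub>0 'k) set" where
  "tensor_relations V W =
     {Poly_Mapping.single (v \<oplus>\<^bsub>V\<^esub> v', w) 1 - Poly_Mapping.single (v, w) 1
        - Poly_Mapping.single (v', w) 1
        | v v' w. v \<in> carrier V \<and> v' \<in> carrier V \<and> w \<in> carrier W} \<union>
     {Poly_Mapping.single (v, w \<oplus>\<^bsub>W\<^esub> w') 1 - Poly_Mapping.single (v, w) 1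
        - Poly_Mapping.single (v, w') 1
        | v w w'. v \<in> carrier V \<and> w \<in> carrier W \<and> w' \<in> carrier W} \<union>
     {Poly_Mapping.single (c \<odot>\<^bsub>V\<^esub> v, w) 1 - Poly_Mapping.single (v, w) c
        | c v w. v \<in> carrier V \<and> w \<in> carrier W} \<union>
     {Poly_Mapping.single (v, c \<odot>\<^bsub>W\<^esub> w) 1 - Poly_Mapping.single (v, w) c
        | c v w. v \<in> carrier V \<and> w \<in> carrier W}"

definition tensor_kernel ::
    "('k::field, 'v, 'm) module_scheme \<Rightarrow> ('k, 'w, 'n) module_scheme \<Rightarrow> ('v \<times> 'w \<Rightarrow>\<^sub>0 'k) set" where
  "tensor_kernel V W =
     LinearCombinations.module.span class_ring (free_module (carrier V \<times> carrier W))
       (tensor_relations V W)"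

definition tensor_product ::
    "('k::field, 'v, 'm) module_scheme \<Rightarrow> ('k, 'w, 'n) module_scheme \<Rightarrow>
      ('k, ('v \<times> 'w \<Rightarrow>\<^sub>0 'k) set) module" where
  "tensor_product V W =
     quotient_module (free_module (carrier V \<times> carrier W)) (tensor_kernel V W)"

text \<open>The element of the dual of the tensor product of \<open>V\<close> and \<open>W\<close> that is identified with the
  tensor of \<open>f\<close> and \<open>e\<close>: it sends the class of $\sum_i c_i (v_i, w_i)$ to
  $\sum_i c_i f(v_i) e(w_i)$, independently of the representative if \<open>f\<close> and \<open>e\<close> are linear.\<close>

definition tensor_form ::
    "('v \<Rightarrow> 'k) \<Rightarrow> ('w \<Rightarrow> 'k) \<Rightarrow> ('v \<times> 'w \<Rightarrow>\<^sub>0 'k::field) set \<Rightarrow> 'k" where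
  "tensor_form f e X =
     (THE c. \<forall>p \<in> X. c = (\<Sum>(v, w) \<in> Poly_Mapping.keys p. Poly_Mapping.lookup p (v, w) * (f v * e w)))"

text \<open>The bilinear extension of $((x, a), (y, b)) \mapsto ([x, y], ab)$ to the free module.\<close>

definition free_bracket ::
    "('k::field, 'g, 'm) lie_alg_scheme \<Rightarrow> ('k, 'a, 'n) module_scheme \<Rightarrow>
      ('g \<times> 'a \<Rightarrow>\<^sub>0 'k) \<Rightarrow> ('g \<times> 'a \<Rightarrow>\<^sub>0 'k) \<Rightarrow> ('g \<times> 'a \<Rightarrow>\<^sub>0 'k)" where
  "free_bracket L A p q =
     (\<Sum>(x, a) \<in> Poly_Mapping.keys p. \<Sum>(y, b) \<in> Poly_Mapping.keys q.
        Poly_Mapping.single (bracket L x y, a \<otimes>\<^bsub>A\<^esub> b)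
          (Poly_Mapping.lookup p (x, a) * Poly_Mapping.lookup q (y, b)))"

definition lie_tensor ::
    "('k::field, 'g, 'm) lie_alg_scheme \<Rightarrow> ('k, 'a, 'n) module_scheme \<Rightarrow>
      ('k, ('g \<times> 'a \<Rightarrow>\<^sub>0 'k) set) lie_alg" where
  "lie_tensor L A =
     module.extend (tensor_product L A)
       (lie_alg.fields
         (\<lambda>X Y. \<Union>p\<in>X. \<Union>q\<in>Y.
            tensor_kernel L A +>\<^bsub>free_module (carrier L \<times> carrier A)\<^esub> free_bracket L A p q))"

end

theory Submission
  imports Defs
begin

text \<open>
  Fix a basis \<open>b\<^sub>i\<close> of the Lie algebra and, for a linear form \<open>f\<close> on it, let \<open>N f\<close> be the matrix with
  entries \<open>f [b\<^sub>i, b\<^sub>j]\<close>; its kernel is the stabilizer of \<open>f\<close>. In the basis \<open>b\<^sub>i \<otimes> \<tau>\<^sup>\<alpha>\<close> of the tensor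
  product, the matrix attached to \<open>F = \<Sum> f\<^sub>\<omega> \<otimes> \<epsilon>\<^sup>\<omega>\<close> is a block matrix: the block at \<open>(\<alpha>, \<beta>)\<close> is
  \<open>N (f\<^sub>\<gamma>)\<close> with \<open>\<gamma> = \<alpha> + \<beta>\<close> if \<open>\<gamma> \<le> \<mu>\<close>, and \<open>0\<close> otherwise. Let \<open>W\<close> be the set of exponents below \<open>\<mu>\<close>
  and let \<open>k\<close> be a lower bound for the nullity of all the matrices \<open>N f\<close>. The heart of the matter is the
  pair of inequalities

    \<open>(card W - 1) * k + nullity (N (f\<^sub>\<mu>)) \<le> nullity of the block matrix \<le> card W * nullity (N (f\<^sub>\<mu>))\<close>

  (\<open>nullity_multi_block\<close>). Taking for \<open>k\<close> the index of the Lie algebra gives everything: the lower bound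
  is at least \<open>card W * k\<close>, this value is attained if \<open>f\<^sub>\<mu>\<close> is regular, and it is attained only if
  \<open>nullity (N (f\<^sub>\<mu>)) \<le> k\<close>. The inequalities hold for every linear space of
  square matrices in place of the matrices \<open>N f\<close>.

  For one variable, with truncation at \<open>t\<^sup>m\<close>, the block matrix is multiplication by the matrix polynomial
  \<open>M(t) = \<Sum> N (f\<^bsub>m-i\<^esub>) t\<^sup>i\<close> on vectors over the truncated polynomial ring. Split the kernel according to
  the order of vanishing at \<open>t = 0\<close>: each of the \<open>m + 1\<close> layers consists of leading coefficients, and
  these lie in the kernel of \<open>M(0) = N (f\<^sub>m)\<close>; this is the upper bound. In the last layer all of that kernel
  occurs, since \<open>t\<^sup>m x\<close> is killed as soon as \<open>M(0) x = 0\<close>. In the other layers the constant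
  terms of the polynomial vectors killed by \<open>M(t)\<close> occur, and these span a space of dimension at
  least \<open>k\<close>: evaluation at many points \<open>t\<close>, where \<open>M(t)\<close> belongs to the linear space and so has nullity at
  least \<open>k\<close>, shows that the polynomial vectors of degree below \<open>D\<close> killed by \<open>M(t)\<close> form a space of
  dimension at least \<open>k * D\<close> up to a bounded error (\<open>fun_dim_poly_kernel_ge\<close>), which is impossible if the
  constant terms span less (\<open>ex_head_ge\<close>). Several variables are treated one at a time, because the
  block matrices for the first variables again form a linear space.

  What remains is to pass from the quotient constructions of the truncated algebra and of the tensor
  product to coordinates. Both are quotients of modules of finitely supported functions by the span of
  relations, and \<open>finsupp_quotient\<close> treats them together.
\<close>

section \<open>Dimensions of spaces of functions\<close>

text \<open>All dimension counts take place in spaces of functions \<open>'c \<Rightarrow> 'k\<close> with support in a finite set. The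
  record makes such a set of functions a vector space in the sense of the library.\<close>

definition fun_space :: "('c \<Rightarrow> 'k::field) set \<Rightarrow> ('k, 'c \<Rightarrow> 'k) module" where
  "fun_space S = \<lparr>carrier = S, mult = undefined, one = undefined, zero = (\<lambda>_. 0),
     add = (\<lambda>x y c. x c + y c), smult = (\<lambda>a x c. a * x c)\<rparr>"

definition fun_subspace :: "('c \<Rightarrow> 'k::field) set \<Rightarrow> bool" where
  "fun_subspace S \<longleftrightarrow> (\<lambda>_. 0) \<in> S \<and> (\<forall>x\<in>S. \<forall>y\<in>S. (\<lambda>c. x c + y c) \<in> S) \<and>
     (\<forall>a. \<forall>x\<in>S. (\<lambda>c. a * x c) \<in> S)"

definition fun_dim :: "('c \<Rightarrow> 'k::field) set \<Rightarrow> nat" where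
  "fun_dim S = vectorspace.dim class_ring (fun_space S)"

definition supported_on :: "'c set \<Rightarrow> ('c \<Rightarrow> 'k::field) set" where
  "supported_on C = {x. \<forall>c. c \<notin> C \<longrightarrow> x c = 0}"

definition lin_on :: "('c \<Rightarrow> 'k::field) set \<Rightarrow> (('c \<Rightarrow> 'k) \<Rightarrow> 'd \<Rightarrow> 'k) \<Rightarrow> bool" where
  "lin_on S T \<longleftrightarrow> (\<forall>x\<in>S. \<forall>y\<in>S. T (\<lambda>c. x c + y c) = (\<lambda>d. T x d + T y d)) \<and>
     (\<forall>a. \<forall>x\<in>S. T (\<lambda>c. a * x c) = (\<lambda>d. a * T x d))"

lemma fun_space_simps [simp]:
  "carrier (fun_space S) = S" "zero (fun_space S) = (\<lambda>_. 0)"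
  "add (fun_space S) x y = (\<lambda>c. x c + y c)" "smult (fun_space S) a x = (\<lambda>c. a * x c)"
  "(fun_space S)\<lparr>carrier := S'\<rparr> = fun_space S'"
  by (simp_all add: fun_space_def)

lemma fun_subspaceD:
  assumes "fun_subspace S"
  shows "(\<lambda>_. 0) \<in> S" "x \<in> S \<Longrightarrow> y \<in> S \<Longrightarrow> (\<lambda>c. x c + y c) \<in> S" "x \<in> S \<Longrightarrow> (\<lambda>c. a * x c) \<in> S"
  using assms by (auto simp: fun_subspace_def)

lemma vectorspace_fun_space:
  assumes "fun_subspace S"
  shows "vectorspace class_ring (fun_space S)"
proof (rule vs_criteria)
  show "\<forall>v\<in>carrier (fun_space S). \<exists>neg_v\<in>carrier (fun_space S).
      v \<oplus>\<^bsub>fun_space S\<^esub> neg_v = \<zero>\<^bsub>fun_space S\<^esub>"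
    using fun_subspaceD(3)[OF assms, where a = "-1"] by (auto intro!: bexI[where x = "\<lambda>c. - 1 * _ c"])
qed (use fun_subspaceD[OF assms] in \<open>auto simp: class_field algebra_simps\<close>)

lemma fun_subspace_supported_on: "fun_subspace (supported_on C)"
  by (auto simp: fun_subspace_def supported_on_def)

text \<open>Linear combinations are formed pointwise; this is what turns the abstract notions of span and
  independence into statements about functions.\<close>

lemma lincomb_fun_space:
  assumes "fun_subspace S" "finite A" "A \<subseteq> S"
  shows "LinearCombinations.module.lincomb (fun_space S) a A = (\<lambda>c. \<Sum>v\<in>A. a v * v c)"
proof -
  interpret vectorspace class_ring "fun_space S" by (rule vectorspace_fun_space[OF assms(1)])
  show ?thesis using assms(2,3)
  proof (induction A rule: finite_induct)
    case empty
    then show ?case by (simp add: lincomb_def)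
  next
    case (insert v A)
    have "lincomb a (insert v A) = a v \<odot>\<^bsub>fun_space S\<^esub> v \<oplus>\<^bsub>fun_space S\<^esub> lincomb a A"
      unfolding lincomb_def using insert
      by (intro M.finsum_insert) (auto simp: fun_subspaceD[OF assms(1)])
    then show ?case using insert by simp
  qed
qed

lemma supported_on_fin_dim:
  fixes C :: "'c set"
  assumes "finite C"
  shows "vectorspace.fin_dim class_ring (fun_space (supported_on C :: ('c \<Rightarrow> 'k::field) set))"
    and "fun_dim (supported_on C :: ('c \<Rightarrow> 'k::field) set) = card C"
proof -
  let ?V = "fun_space (supported_on C :: ('c \<Rightarrow> 'k::field) set)"
  interpret vectorspace class_ring ?V by (rule vectorspace_fun_space[OF fun_subspace_supported_on])
  define d where "d = (\<lambda>c::'c. \<lambda>c'. if c' = c then 1 else (0::'k))"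
  have dC: "d ` C \<subseteq> supported_on C" by (auto simp: d_def supported_on_def)
  have inj: "inj_on d C" by (auto simp: d_def inj_on_def fun_eq_iff split: if_splits)
  have lc: "lincomb a (d ` C) = (\<lambda>c'. if c' \<in> C then a (d c') else 0)" for a
    using dC assms
    by (subst lincomb_fun_space[OF fun_subspace_supported_on])
       (auto simp: sum.reindex[OF inj] inj fun_eq_iff, auto simp: d_def if_distrib[of "\<lambda>z. _ * z"] cong: if_cong)
  have "span (d ` C) = carrier ?V"
  proof -
    have "\<exists>a. x = (\<lambda>c'. if c' \<in> C then a (d c') else 0)" if "x \<in> supported_on C" for x
      by (rule exI[of _ "\<lambda>v. x (inv_into C d v)"]) (use that inj in \<open>auto simp: supported_on_def\<close>)
    then show ?thesis
      using dC by (subst finite_span) (auto simp: assms lc, auto simp: supported_on_def)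
  qed
  moreover have "lin_indpt (d ` C)"
    using dC assms by (intro finite_lin_indpt2) (auto simp: lc fun_eq_iff split: if_splits)
  ultimately have "basis (d ` C)" using dC by (simp add: basis_def)
  then show "fin_dim" "fun_dim (supported_on C :: ('c \<Rightarrow> 'k::field) set) = card C"
    using dim_basis[of "d ` C"] assms inj by (auto simp: fin_dim_def basis_def fun_dim_def card_image)
qed

text \<open>The library requires a finite generating set. An independent subset stays independent in the
  ambient space of functions with support in \<open>C\<close>, so its size is bounded, and a maximal one generates.\<close>

lemma fun_subspace_fin_dim:
  fixes S :: "('c \<Rightarrow> 'k::field) set"
  assumes "fun_subspace S" "S \<subseteq> supported_on C" "finite C"
  shows "vectorspace.fin_dim class_ring (fun_space S)"
proof -
  let ?F = "fun_space (supported_on C :: ('c \<Rightarrow> 'k) set)" and ?S = "fun_space S"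
  interpret F: vectorspace class_ring ?F by (rule vectorspace_fun_space[OF fun_subspace_supported_on])
  interpret S: vectorspace class_ring ?S by (rule vectorspace_fun_space[OF assms(1)])
  have sub: "submodule class_ring S ?F"
    using assms F.module_axioms by (auto simp: submodule_def fun_subspace_def)
  have "finite A \<and> card A \<le> vectorspace.dim class_ring ?F" if "A \<subseteq> S" "S.lin_indpt A" for A
  proof -
    have "A \<subseteq> carrier ?F" "F.lin_indpt A"
      using F.span_li_not_depend(2)[OF that(1) sub] that assms(2) by auto
    then show ?thesis
      using F.li_le_dim[OF supported_on_fin_dim(1)[OF assms(3)], of A] by simp
  qed
  then obtain A where A: "finite A" "maximal A (\<lambda>A. A \<subseteq> carrier ?S \<and> S.lin_indpt A)"
    using maximal_exists[of "\<lambda>A. A \<subseteq> carrier ?S \<and> S.lin_indpt A" "vectorspace.dim class_ring ?F" "{}"]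
    by (auto simp: S.lin_dep_def)
  then have "S.basis A" by (intro S.max_li_is_basis)
  then show ?thesis
    unfolding S.fin_dim_def S.basis_def using A(1) by blast
qed

lemma lin_onD:
  assumes "lin_on S T"
  shows "x \<in> S \<Longrightarrow> y \<in> S \<Longrightarrow> T (\<lambda>c. x c + y c) = (\<lambda>d. T x d + T y d)"
    "x \<in> S \<Longrightarrow> T (\<lambda>c. a * x c) = (\<lambda>d. a * T x d)"
  using assms by (auto simp: lin_on_def)

lemma fun_subspace_image:
  assumes "fun_subspace S" "lin_on S T"
  shows "fun_subspace (T ` S)"
  unfolding fun_subspace_def
proof (intro conjI ballI allI)
  show "(\<lambda>_. 0) \<in> T ` S"
    using lin_onD(2)[OF assms(2) fun_subspaceD(1)[OF assms(1)], of 0] fun_subspaceD(1)[OF assms(1)]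
    by (auto intro!: image_eqI[of _ _ "\<lambda>_. 0"])
  fix x assume "x \<in> T ` S"
  then obtain x' where x: "x' \<in> S" "x = T x'" by auto
  show "(\<lambda>c. a * x c) \<in> T ` S" for a
    using lin_onD(2)[OF assms(2) x(1), of a] fun_subspaceD(3)[OF assms(1) x(1), of a] x by (metis imageI)
  fix y assume "y \<in> T ` S"
  then obtain y' where y: "y' \<in> S" "y = T y'" by auto
  show "(\<lambda>c. x c + y c) \<in> T ` S"
    using lin_onD(1)[OF assms(2) x(1) y(1)] fun_subspaceD(2)[OF assms(1) x(1) y(1)] x y by (metis imageI)
qed

lemma linear_map_fun_space:
  assumes "fun_subspace S" "lin_on S T" "T ` S \<subseteq> S'" "fun_subspace S'"
  shows "linear_map class_ring (fun_space S) (fun_space S') T"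
proof -
  interpret S: vectorspace class_ring "fun_space S" by (rule vectorspace_fun_space[OF assms(1)])
  interpret S': vectorspace class_ring "fun_space S'" by (rule vectorspace_fun_space[OF assms(4)])
  show ?thesis
    by unfold_locales (use assms lin_onD[OF assms(2)] in \<open>auto simp: LinearCombinations.module_hom_def\<close>)
qed

lemma rank_nullity_fun_dim:
  assumes "fun_subspace S" "S \<subseteq> supported_on C" "finite C" "lin_on S T"
  shows "fun_dim (T ` S) + fun_dim {x \<in> S. T x = (\<lambda>_. 0)} = fun_dim S"
proof -
  interpret linear_map class_ring "fun_space S" "fun_space (T ` S)" T
    using assms fun_subspace_image by (intro linear_map_fun_space) auto
  show ?thesis
    using rank_nullity[OF fun_subspace_fin_dim[OF assms(1-3)]]
    by (simp add: fun_dim_def im_def ker_def)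
qed

lemma fun_dim_inj:
  assumes "fun_subspace S" "S \<subseteq> supported_on C" "finite C" "lin_on S T" "inj_on T S"
  shows "fun_dim (T ` S) = fun_dim S"
proof -
  interpret linear_map class_ring "fun_space S" "fun_space (T ` S)" T
    using assms fun_subspace_image by (intro linear_map_fun_space) auto
  show ?thesis
    using dim_eq[OF fun_subspace_fin_dim[OF assms(1-3)]] assms by (simp add: fun_dim_def)
qed

lemma fun_dim_mono:
  assumes "fun_subspace S" "fun_subspace S'" "S \<subseteq> S'" "S' \<subseteq> supported_on C" "finite C"
  shows "fun_dim S \<le> fun_dim S'"
proof -
  interpret S': vectorspace class_ring "fun_space S'" by (rule vectorspace_fun_space[OF assms(2)])
  interpret S: vectorspace class_ring "fun_space S" by (rule vectorspace_fun_space[OF assms(1)])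
  have sub: "submodule class_ring S (fun_space S')"
    using assms S'.module_axioms by (auto simp: submodule_def fun_subspace_def)
  obtain B where B: "finite B" "S.basis B"
    using S.finite_basis_exists fun_subspace_fin_dim assms by blast
  then have "card B \<le> S'.dim"
    using S'.li_le_dim[OF fun_subspace_fin_dim[OF assms(2,4,5)], of B] S'.span_li_not_depend(2)[OF _ sub, of B] assms(3)
    by (auto simp: S.basis_def)
  then show ?thesis using S.dim_basis[OF B] by (simp add: fun_dim_def)
qed

text \<open>Injective linear coordinates carry both the vector space axioms and the dimension back to the given
  record, so quotients and subspaces need no separate proof that they are vector spaces.\<close>

lemma dim_via_coordinates:
  fixes M :: "('k::field, 'v, 'n) module_scheme" and \<phi> :: "'v \<Rightarrow> 'c \<Rightarrow> 'k"
  assumes zero: "\<zero>\<^bsub>M\<^esub> \<in> carrier M" "\<phi> \<zero>\<^bsub>M\<^esub> = (\<lambda>_. 0)"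
    and add: "\<And>x y. x \<in> carrier M \<Longrightarrow> y \<in> carrier M \<Longrightarrow>
      x \<oplus>\<^bsub>M\<^esub> y \<in> carrier M \<and> \<phi> (x \<oplus>\<^bsub>M\<^esub> y) = (\<lambda>c. \<phi> x c + \<phi> y c)"
    and smult: "\<And>a x. x \<in> carrier M \<Longrightarrow>
      a \<odot>\<^bsub>M\<^esub> x \<in> carrier M \<and> \<phi> (a \<odot>\<^bsub>M\<^esub> x) = (\<lambda>c. a * \<phi> x c)"
    and inj: "inj_on \<phi> (carrier M)"
    and C: "\<phi> ` carrier M \<subseteq> supported_on C" "finite C"
  shows "vectorspace.dim class_ring M = fun_dim (\<phi> ` carrier M)"
proof -
  have eqI: "x = y" if "\<phi> x = \<phi> y" "x \<in> carrier M" "y \<in> carrier M" for x y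
    using inj that by (auto dest: inj_onD)
  have M: "vectorspace class_ring M"
  proof (rule vs_criteria)
    show "\<forall>v\<in>carrier M. \<exists>w\<in>carrier M. v \<oplus>\<^bsub>M\<^esub> w = \<zero>\<^bsub>M\<^esub>"
    proof
      fix v assume v: "v \<in> carrier M"
      show "\<exists>w\<in>carrier M. v \<oplus>\<^bsub>M\<^esub> w = \<zero>\<^bsub>M\<^esub>"
        by (rule bexI[of _ "(-1) \<odot>\<^bsub>M\<^esub> v"], rule eqI) (use v add smult zero in simp_all)
    qed
  qed (use zero add smult in \<open>auto simp: class_field algebra_simps intro!: eqI\<close>)
  have S: "fun_subspace (\<phi> ` carrier M)"
    unfolding fun_subspace_def
  proof (intro conjI ballI allI)
    show "(\<lambda>_. 0) \<in> \<phi> ` carrier M" using zero by (metis imageI)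
    fix x assume "x \<in> \<phi> ` carrier M"
    then obtain x' where x: "x' \<in> carrier M" "x = \<phi> x'" by auto
    show "(\<lambda>c. a * x c) \<in> \<phi> ` carrier M" for a
      using smult[OF x(1), of a] x by (metis imageI)
    fix y assume "y \<in> \<phi> ` carrier M"
    then obtain y' where y: "y' \<in> carrier M" "y = \<phi> y'" by auto
    show "(\<lambda>c. x c + y c) \<in> \<phi> ` carrier M"
      using add[OF x(1) y(1)] x y by (metis imageI)
  qed
  interpret M: vectorspace class_ring M by fact
  interpret S: vectorspace class_ring "fun_space (\<phi> ` carrier M)" by (rule vectorspace_fun_space[OF S])
  let ?i = "inv_into (carrier M) \<phi>"
  have i: "?i x \<in> carrier M" "\<phi> (?i x) = x" if "x \<in> \<phi> ` carrier M" for x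
    using that by (auto simp: inv_into_into f_inv_into_f)
  interpret linear_map class_ring "fun_space (\<phi> ` carrier M)" M ?i
  proof unfold_locales
    show "?i \<in> LinearCombinations.module_hom class_ring (fun_space (\<phi> ` carrier M)) M"
      unfolding LinearCombinations.module_hom_def
      using i add smult inj by (auto intro!: inv_into_f_eq)
  qed
  show "vectorspace.dim class_ring M = fun_dim (\<phi> ` carrier M)"
    using dim_eq[OF fun_subspace_fin_dim[OF S C]] inj by (simp add: fun_dim_def inj_on_inv_into)
qed

section \<open>Nullity of block matrices in one variable\<close>

text \<open>Most subspaces below are common zero sets of linear functionals; the predicate lets one lemma
  handle all of them.\<close>

definition lin_fun :: "(('c \<Rightarrow> 'k::field) \<Rightarrow> 'k) \<Rightarrow> bool" where
  "lin_fun L \<longleftrightarrow> (\<forall>x y. L (\<lambda>c. x c + y c) = L x + L y) \<and> (\<forall>a x. L (\<lambda>c. a * x c) = a * L x)"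

lemma fun_subspace_common_zeros:
  assumes "\<And>i. i \<in> I \<Longrightarrow> lin_fun (L i)"
  shows "fun_subspace {x \<in> supported_on C. \<forall>i\<in>I. L i x = 0}"
proof -
  have "L i (\<lambda>_. 0) = 0" if "i \<in> I" for i
  proof -
    have "L i (\<lambda>c. 0 * undefined c) = 0 * L i undefined"
      using assms[OF that] unfolding lin_fun_def by blast
    then show ?thesis by simp
  qed
  then show ?thesis
    using assms by (auto simp: fun_subspace_def supported_on_def lin_fun_def)
qed

definition ker_mat :: "'c set \<Rightarrow> ('c \<Rightarrow> 'c \<Rightarrow> 'k::field) \<Rightarrow> ('c \<Rightarrow> 'k) set" where
  "ker_mat C N = {x \<in> supported_on C. \<forall>r\<in>C. (\<Sum>c\<in>C. N r c * x c) = 0}"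

definition nullity :: "'c set \<Rightarrow> ('c \<Rightarrow> 'c \<Rightarrow> 'k::field) \<Rightarrow> nat" where
  "nullity C N = fun_dim (ker_mat C N)"

lemma fun_subspace_ker_mat: "fun_subspace (ker_mat C N)"
  unfolding ker_mat_def
  by (rule fun_subspace_common_zeros) (simp add: lin_fun_def sum.distrib sum_distrib_left algebra_simps)

lemma ker_mat_subset: "ker_mat C N \<subseteq> supported_on C"
  by (auto simp: ker_mat_def)

definition mat_app :: "'c set \<Rightarrow> ('c \<Rightarrow> 'c \<Rightarrow> 'k::field) \<Rightarrow> ('c \<Rightarrow> 'k) \<Rightarrow> 'c \<Rightarrow> 'k" where
  "mat_app C N x = (\<lambda>r. if r \<in> C then \<Sum>c\<in>C. N r c * x c else 0)"

lemma lin_on_mat_app: "lin_on S (mat_app C N)"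
  by (auto simp: lin_on_def mat_app_def fun_eq_iff sum.distrib sum_distrib_left algebra_simps)

lemma mat_app_zero_iff: "mat_app C N x = (\<lambda>_. 0) \<longleftrightarrow> (\<forall>r\<in>C. (\<Sum>c\<in>C. N r c * x c) = 0)"
  by (auto simp: mat_app_def fun_eq_iff)

lemma rank_add_nullity:
  assumes "finite C"
  shows "fun_dim (mat_app C N ` supported_on C) + nullity C N = card C"
  using rank_nullity_fun_dim[OF fun_subspace_supported_on order_refl assms lin_on_mat_app, of C N] supported_on_fin_dim(2)[OF assms]
  by (simp add: nullity_def ker_mat_def mat_app_zero_iff)

lemma nullity_le: "finite C \<Longrightarrow> nullity C N \<le> card C"
  using rank_add_nullity[of C N] by linarith

lemma nullity_reindex:
  fixes g :: "'d \<Rightarrow> 'c" and N :: "'c \<Rightarrow> 'c \<Rightarrow> 'k::field"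
  assumes "finite C" "bij_betw g D C"
    and eq: "\<And>r c. r \<in> D \<Longrightarrow> c \<in> D \<Longrightarrow> N' r c = N (g r) (g c)"
  shows "nullity D N' = nullity C N"
proof -
  define T where "T = (\<lambda>x::'c \<Rightarrow> 'k. \<lambda>d. if d \<in> D then x (g d) else 0)"
  have C: "C = g ` D" and inj: "inj_on g D" using assms(2) by (auto simp: bij_betw_def)
  have sums: "(\<Sum>c\<in>D. N' r c * T x c) = (\<Sum>c\<in>C. N (g r) c * x c)" if "r \<in> D" for r x
    unfolding C sum.reindex[OF inj] using that by (auto simp: T_def eq intro!: sum.cong)
  have "T ` ker_mat C N = ker_mat D N'"
  proof (intro equalityI subsetI)
    fix y assume y: "y \<in> ker_mat D N'"
    define x where "x = (\<lambda>c. if c \<in> C then y (inv_into D g c) else 0)"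
    have "T x = y" using y inj by (auto simp: T_def x_def C ker_mat_def supported_on_def fun_eq_iff)
    moreover have "x \<in> ker_mat C N"
      using y sums[of _ x] unfolding \<open>T x = y\<close> by (auto simp: ker_mat_def supported_on_def C x_def)
    ultimately show "y \<in> T ` ker_mat C N" by blast
  qed (auto simp: ker_mat_def sums C, auto simp: T_def supported_on_def)
  moreover have "inj_on T (ker_mat C N)"
  proof (rule inj_onI)
    fix x y assume *: "x \<in> ker_mat C N" "y \<in> ker_mat C N" "T x = T y"
    have "x (g d) = y (g d)" if "d \<in> D" for d using fun_cong[OF *(3), of d] that by (simp add: T_def)
    moreover have "x c = 0" "y c = 0" if "c \<notin> C" for c
      using * that by (auto simp: ker_mat_def supported_on_def)
    ultimately show "x = y" unfolding C by (intro ext) (metis imageE)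
  qed
  moreover have "lin_on (ker_mat C N) T" by (auto simp: lin_on_def T_def fun_eq_iff)
  ultimately show ?thesis
    unfolding nullity_def using fun_dim_inj[OF fun_subspace_ker_mat[of C N] ker_mat_subset assms(1), where T = T] by simp
qed

text \<open>Coefficient \<open>j\<close> of the product of the matrix power series \<open>\<Sum> a\<^sub>i t\<^sup>i\<close> with the vector power series
  whose coefficients are \<open>v (j, _)\<close>.\<close>

definition conv_coeff :: "'c set \<Rightarrow> (nat \<Rightarrow> 'c \<Rightarrow> 'c \<Rightarrow> 'k::field) \<Rightarrow> (nat \<times> 'c \<Rightarrow> 'k) \<Rightarrow> nat \<Rightarrow> 'c \<Rightarrow> 'k" where
  "conv_coeff C a v j r = (\<Sum>i\<le>j. \<Sum>c\<in>C. a i r c * v (j - i, c))"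

text \<open>Polynomial vectors of degree below \<open>D\<close> whose image vanishes up to order \<open>J\<close>. The case \<open>D = J\<close> is the
  kernel over the truncated polynomial ring. If the matrix polynomial has degree at most \<open>m\<close>, then the case
  \<open>J = D + m\<close> is the exact kernel in degrees below \<open>D\<close>. Both are needed, hence two parameters.\<close>

definition conv_ker :: "'c set \<Rightarrow> (nat \<Rightarrow> 'c \<Rightarrow> 'c \<Rightarrow> 'k::field) \<Rightarrow> nat \<Rightarrow> nat \<Rightarrow> (nat \<times> 'c \<Rightarrow> 'k) set" where
  "conv_ker C a D J = {v \<in> supported_on ({..<D} \<times> C). \<forall>(j, r) \<in> {..<J} \<times> C. conv_coeff C a v j r = 0}"

definition head :: "(nat \<times> 'c \<Rightarrow> 'k) \<Rightarrow> 'c \<Rightarrow> 'k" where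
  "head v = (\<lambda>c. v (0, c))"

lemma fun_subspace_conv_ker: "fun_subspace (conv_ker C a D J)"
proof -
  have "conv_ker C a D J = {v \<in> supported_on ({..<D} \<times> C). \<forall>i\<in>{..<J} \<times> C. conv_coeff C a v (fst i) (snd i) = 0}"
    by (auto simp: conv_ker_def)
  then show ?thesis
    by (simp only:, intro fun_subspace_common_zeros)
       (simp add: lin_fun_def conv_coeff_def sum.distrib sum_distrib_left algebra_simps)
qed

lemma lin_on_head: "lin_on S head"
  by (auto simp: lin_on_def head_def)

lemma conv_ker_subset: "conv_ker C a D J \<subseteq> supported_on ({..<D} \<times> C)"
  by (auto simp: conv_ker_def)

lemma head_conv_ker_subset: "head ` conv_ker C a D J \<subseteq> supported_on C"
  by (auto simp: conv_ker_def head_def supported_on_def)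

text \<open>Taking the constant term is a linear map, and division by \<open>t\<close> identifies its kernel with a space of
  the same kind whose two parameters are smaller by one. Iterating this splits the kernel into layers.\<close>

lemma conv_ker_step:
  fixes a :: "nat \<Rightarrow> 'c \<Rightarrow> 'c \<Rightarrow> 'k::field"
  assumes "finite C"
  shows "fun_dim (conv_ker C a (Suc D) (Suc J)) =
    fun_dim (head ` conv_ker C a (Suc D) (Suc J)) + fun_dim (conv_ker C a D J)"
proof -
  define T where "T = (\<lambda>w::nat \<times> 'c \<Rightarrow> 'k. \<lambda>(j, c). case j of 0 \<Rightarrow> 0 | Suc i \<Rightarrow> w (i, c))"
  have conv0: "conv_coeff C a (T w) 0 r = 0" for w r by (simp add: conv_coeff_def T_def)
  have convS: "conv_coeff C a (T w) (Suc j) r = conv_coeff C a w j r" for w j r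
    by (auto simp: conv_coeff_def T_def Suc_diff_le intro!: sum.cong)
  have "T ` conv_ker C a D J = {v \<in> conv_ker C a (Suc D) (Suc J). head v = (\<lambda>_. 0)}"
  proof (intro equalityI subsetI)
    fix v assume v: "v \<in> {v \<in> conv_ker C a (Suc D) (Suc J). head v = (\<lambda>_. 0)}"
    define w where "w = (\<lambda>(j, c). v (Suc j, c))"
    have 1: "T w = v"
      using v by (auto simp: T_def w_def head_def fun_eq_iff split: nat.splits)
    moreover have "w \<in> conv_ker C a D J"
    proof -
      have "conv_coeff C a w j r = 0" if "j < J" "r \<in> C" for j r
        using v convS[of w j r] that unfolding 1 by (auto simp: conv_ker_def)
      moreover have "w \<in> supported_on ({..<D} \<times> C)"
        using v by (auto simp: conv_ker_def supported_on_def w_def)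
      ultimately show ?thesis by (auto simp: conv_ker_def)
    qed
    ultimately show "v \<in> T ` conv_ker C a D J" by blast
  next
    fix v assume "v \<in> T ` conv_ker C a D J"
    then obtain w where w: "w \<in> conv_ker C a D J" "v = T w" by auto
    have "conv_coeff C a v j r = 0" if "j < Suc J" "r \<in> C" for j r
      using w that by (cases j) (auto simp: conv0 convS conv_ker_def)
    then show "v \<in> {v \<in> conv_ker C a (Suc D) (Suc J). head v = (\<lambda>_. 0)}"
      using w by (auto simp: conv_ker_def supported_on_def T_def head_def split: nat.splits)
  qed
  moreover have "inj_on T (conv_ker C a D J)"
  proof (rule inj_onI)
    fix x y assume "T x = T y"
    then have "T x (Suc j, c) = T y (Suc j, c)" for j c by simp
    then show "x = y" by (auto simp: T_def)
  qed
  moreover have "lin_on (conv_ker C a D J) T"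
    by (auto simp: lin_on_def T_def fun_eq_iff split: nat.splits)
  ultimately have "fun_dim {v \<in> conv_ker C a (Suc D) (Suc J). head v = (\<lambda>_. 0)} = fun_dim (conv_ker C a D J)"
    using fun_dim_inj[OF fun_subspace_conv_ker[of C a D J] conv_ker_subset, where T = T] assms by simp
  then show ?thesis
    using rank_nullity_fun_dim[OF fun_subspace_conv_ker[of C a "Suc D" "Suc J"] conv_ker_subset _ lin_on_head] assms
    by simp
qed

lemma fun_dim_conv_ker_0 [simp]: "fun_dim (conv_ker C a 0 J) = 0"
proof -
  have "conv_ker C a 0 J = (supported_on {} :: (nat \<times> 'a \<Rightarrow> 'b) set)"
    by (auto simp: conv_ker_def supported_on_def conv_coeff_def)
  then show ?thesis using supported_on_fin_dim(2)[of "{}"] by simp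
qed

lemma conv_0: "conv_coeff C a v 0 r = (\<Sum>c\<in>C. a 0 r c * head v c)"
  by (simp add: conv_coeff_def head_def)

text \<open>The constant term of a vector in the kernel is killed by the constant matrix, so each layer
  contributes at most its nullity.\<close>

lemma fun_dim_conv_ker_le:
  assumes "finite C"
  shows "fun_dim (conv_ker C a q q) \<le> q * nullity C (a 0)"
proof (induction q)
  case (Suc q)
  have "head ` conv_ker C a (Suc q) (Suc q) \<subseteq> ker_mat C (a 0)"
    using head_conv_ker_subset[of C a "Suc q" "Suc q"]
    by (auto simp: ker_mat_def conv_ker_def simp flip: conv_0)
  then have "fun_dim (head ` conv_ker C a (Suc q) (Suc q)) \<le> nullity C (a 0)"
    unfolding nullity_def
    by (intro fun_dim_mono[OF fun_subspace_image[OF fun_subspace_conv_ker lin_on_head] fun_subspace_ker_mat])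
       (use assms in \<open>auto simp: ker_mat_def\<close>)
  then show ?case using Suc conv_ker_step[OF assms, of a q q] by simp
qed simp

definition poly_mat :: "nat \<Rightarrow> (nat \<Rightarrow> 'c \<Rightarrow> 'c \<Rightarrow> 'k::field) \<Rightarrow> 'k \<Rightarrow> 'c \<Rightarrow> 'c \<Rightarrow> 'k" where
  "poly_mat m a t r c = (\<Sum>i\<le>m. a i r c * t ^ i)"

definition eval_vec :: "nat \<Rightarrow> 'k::field \<Rightarrow> (nat \<times> 'c \<Rightarrow> 'k) \<Rightarrow> 'c \<Rightarrow> 'k" where
  "eval_vec D t v c = (\<Sum>j<D. v (j, c) * t ^ j)"

text \<open>Each entry of \<open>M(t) v(t)\<close> is a polynomial in \<open>t\<close> of degree below \<open>D + m\<close>, so it vanishes if it has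
  \<open>D + m\<close> distinct roots. In characteristic zero the points \<open>0, \<dots>, D + m - 1\<close> are distinct.\<close>

lemma conv_zero_if_zero_at_points:
  fixes a :: "nat \<Rightarrow> 'c \<Rightarrow> 'c \<Rightarrow> 'k::field_char_0"
  assumes "finite C" and deg: "\<And>i. m < i \<Longrightarrow> a i = (\<lambda>_ _. 0)"
    and v: "v \<in> supported_on ({..<D} \<times> C)"
    and zero: "\<And>p. p < D + m \<Longrightarrow> (\<Sum>c\<in>C. poly_mat m a (of_nat p) r c * eval_vec D (of_nat p) v c) = 0"
  shows "conv_coeff C a v j r = 0"
proof -
  define A where "A = (\<lambda>c. \<Sum>i\<le>m. monom (a i r c) i)"
  define V where "V = (\<lambda>c. \<Sum>j<D. monom (v (j, c)) j)"
  define Q where "Q = (\<Sum>c\<in>C. A c * V c)"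
  have cA: "Polynomial.coeff (A c) i = a i r c" for c i
    by (cases "i \<le> m") (auto simp: A_def coeff_sum deg)
  have cV: "Polynomial.coeff (V c) j = v (j, c)" for c j
    using v by (cases "j < D") (auto simp: V_def coeff_sum supported_on_def)
  have cQ: "Polynomial.coeff Q j = conv_coeff C a v j r" for j
    unfolding Q_def conv_coeff_def by (subst sum.swap) (simp add: coeff_sum coeff_mult cA cV)
  have pQ: "poly Q t = (\<Sum>c\<in>C. poly_mat m a t r c * eval_vec D t v c)" for t
    by (simp add: Q_def poly_sum A_def V_def poly_monom poly_mat_def eval_vec_def)
  have "Q = 0"
  proof (rule ccontr)
    assume "Q \<noteq> 0"
    have "Polynomial.coeff Q j = 0" if "j \<ge> D + m" for j
      unfolding cQ conv_coeff_def
    proof (intro sum.neutral ballI)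
      fix i c assume "i \<in> {..j}" "c \<in> C"
      show "a i r c * v (j - i, c) = 0"
        using that deg[of i] v by (cases "m < i") (auto simp: supported_on_def less_diff_conv2)
    qed
    then have "degree Q < D + m" using \<open>Q \<noteq> 0\<close> by (metis leading_coeff_0_iff not_less)
    moreover have "(of_nat :: nat \<Rightarrow> 'k) ` {..<D + m} \<subseteq> {x. poly Q x = 0}"
      using zero by (auto simp: pQ)
    then have "card ((of_nat :: nat \<Rightarrow> 'k) ` {..<D + m}) \<le> card {x. poly Q x = 0}"
      using \<open>Q \<noteq> 0\<close> by (intro card_mono poly_roots_finite)
    then have "D + m \<le> card {x. poly Q x = 0}"
      by (simp add: card_image inj_on_def)
    moreover have "card {x. poly Q x = 0} \<le> degree Q"
      using \<open>Q \<noteq> 0\<close> by (rule card_poly_roots_bound)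
    ultimately show False by linarith
  qed
  then show ?thesis using cQ[of j] by simp
qed

text \<open>A polynomial vector is killed by \<open>M(t)\<close> once \<open>M(p) v(p) = 0\<close> at \<open>D + m\<close> points \<open>p\<close>, and each point
  imposes at most as many linear conditions as the rank of \<open>M(p)\<close>, that is at most \<open>card C - k\<close>, on the \<open>D * card C\<close> coefficients.\<close>

lemma fun_dim_poly_kernel_ge:
  fixes a :: "nat \<Rightarrow> 'c \<Rightarrow> 'c \<Rightarrow> 'k::field_char_0"
  assumes fin: "finite C" and deg: "\<And>i. m < i \<Longrightarrow> a i = (\<lambda>_ _. 0)"
    and k: "\<And>t. k \<le> nullity C (poly_mat m a t)"
  shows "D * card C \<le> fun_dim (conv_ker C a D (D + m)) + (D + m) * (card C - k)"
proof -
  define L where "L = (\<lambda>(p, r). \<lambda>v. \<Sum>c\<in>C. poly_mat m a (of_nat p) r c * eval_vec D (of_nat p) v c)"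
  define S where "S = (\<lambda>p. {v \<in> supported_on ({..<D} \<times> C). \<forall>i\<in>{..<p} \<times> C. L i v = 0})"
  have sub: "fun_subspace (S p)" for p
    unfolding S_def
    by (rule fun_subspace_common_zeros)
       (auto simp: L_def lin_fun_def eval_vec_def sum.distrib sum_distrib_left algebra_simps)
  have SF: "S p \<subseteq> supported_on ({..<D} \<times> C)" for p by (auto simp: S_def)
  have "D * card C \<le> fun_dim (S p) + p * (card C - k)" for p
  proof (induction p)
    case 0
    have "S 0 = supported_on ({..<D} \<times> C)" by (auto simp: S_def)
    then show ?case using fin by (simp add: supported_on_fin_dim)
  next
    case (Suc p)
    define T where "T = (\<lambda>v. mat_app C (poly_mat m a (of_nat p))
      (\<lambda>c. if c \<in> C then eval_vec D (of_nat p) v c else 0))"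
    have lin: "lin_on (S p) T"
      by (auto simp: lin_on_def T_def mat_app_def fun_eq_iff eval_vec_def sum.distrib
          sum_distrib_left algebra_simps)
    have ker: "{v \<in> S p. T v = (\<lambda>_. 0)} = S (Suc p)"
      by (auto simp: S_def L_def T_def mat_app_zero_iff less_Suc_eq cong: sum.cong)
    have "T ` S p \<subseteq> mat_app C (poly_mat m a (of_nat p)) ` supported_on C"
      unfolding T_def by (auto simp: supported_on_def)
    then have "fun_dim (T ` S p) \<le> fun_dim (mat_app C (poly_mat m a (of_nat p)) ` supported_on C)"
      by (intro fun_dim_mono[of _ _ C] fun_subspace_image[OF sub lin] fun_subspace_image[OF fun_subspace_supported_on lin_on_mat_app])
         (auto simp: fin mat_app_def supported_on_def)
    also have "\<dots> \<le> card C - k"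
      using rank_add_nullity[OF fin, of "poly_mat m a (of_nat p)"] k[of "of_nat p"] by linarith
    finally have "fun_dim (S p) \<le> fun_dim (S (Suc p)) + (card C - k)"
      using rank_nullity_fun_dim[OF sub SF _ lin] fin by (simp add: ker)
    then show ?case using Suc by simp
  qed
  moreover have "S (D + m) \<subseteq> conv_ker C a D (D + m)"
    using conv_zero_if_zero_at_points[OF fin deg] by (fastforce simp: S_def conv_ker_def L_def)
  then have "fun_dim (S (D + m)) \<le> fun_dim (conv_ker C a D (D + m))"
    using fin by (intro fun_dim_mono[OF sub fun_subspace_conv_ker _ conv_ker_subset]) auto
  ultimately show ?thesis by (meson add_le_mono1 le_trans)
qed

text \<open>If the constant terms always spanned less than \<open>k\<close> dimensions, then the exact kernel in degrees
  below \<open>D\<close> would have dimension at most \<open>D * (k - 1)\<close>, which the linear growth \<open>D * k - m * (card C - k)\<close>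
  exceeds for large \<open>D\<close>.\<close>

lemma ex_head_ge:
  fixes a :: "nat \<Rightarrow> 'c \<Rightarrow> 'c \<Rightarrow> 'k::field_char_0"
  assumes fin: "finite C" and deg: "\<And>i. m < i \<Longrightarrow> a i = (\<lambda>_ _. 0)"
    and k: "\<And>t. k \<le> nullity C (poly_mat m a t)"
  shows "\<exists>D. k \<le> fun_dim (head ` conv_ker C a (Suc D) (Suc D + m))"
proof (rule ccontr)
  assume "\<not> ?thesis"
  then have small: "fun_dim (head ` conv_ker C a (Suc D) (Suc D + m)) < k" for D by (auto simp: not_le)
  \<comment> \<open>each layer has dimension at most \<open>k - 1\<close>\<close>
  have up: "fun_dim (conv_ker C a D (D + m)) \<le> D * (k - 1)" for D
  proof (induction D)
    case (Suc D)
    then show ?case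
      using conv_ker_step[OF fin, of a D "D + m"] small[of D] by simp
  qed simp
  have kC: "k \<le> card C" using k[of 0] nullity_le[OF fin, of "poly_mat m a 0"] by linarith
  obtain s where s: "card C = k + s" using kC by (metis le_add_diff_inverse)
  have k0: "0 < k" using small[of 0] by auto
  then obtain k' where k': "k = Suc k'" by (cases k) auto
  \<comment> \<open>with \<open>s = card C - k\<close>, the two bounds give \<open>D \<le> m * s\<close>; this \<open>D\<close> violates it\<close>
  let ?D = "Suc (m * s)"
  have "?D * (k + s) \<le> ?D * k' + (?D + m) * s"
    using order_trans[OF fun_dim_poly_kernel_ge[OF fin deg k, of ?D] add_right_mono[OF up[of ?D]]] s k' by simp
  then have "?D \<le> m * s" unfolding k' by (simp add: algebra_simps)
  then show False by simp
qed

text \<open>Truncating an exact polynomial solution gives a solution over the truncated ring with the same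
  constant term. Hence every layer has dimension at least \<open>k\<close>; the last one is the whole kernel of \<open>a 0\<close>.\<close>

lemma fun_dim_conv_ker_ge:
  fixes a :: "nat \<Rightarrow> 'c \<Rightarrow> 'c \<Rightarrow> 'k::field_char_0"
  assumes fin: "finite C" and deg: "\<And>i. m < i \<Longrightarrow> a i = (\<lambda>_ _. 0)"
    and k: "\<And>t. k \<le> nullity C (poly_mat m a t)"
  shows "q * k + nullity C (a 0) \<le> fun_dim (conv_ker C a (Suc q) (Suc q))"
proof (induction q)
  case 0
  have "ker_mat C (a 0) \<subseteq> head ` conv_ker C a 1 1"
  proof
    fix x assume x: "x \<in> ker_mat C (a 0)"
    define v where "v = (\<lambda>(j, c). if j = (0::nat) then x c else 0)"
    have "head v = x" by (simp add: head_def v_def)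
    moreover have "v \<in> conv_ker C a 1 1"
      using x by (auto simp: conv_ker_def conv_0 \<open>head v = x\<close> ker_mat_def, auto simp: v_def supported_on_def)
    ultimately show "x \<in> head ` conv_ker C a 1 1" by blast
  qed
  then have "nullity C (a 0) \<le> fun_dim (head ` conv_ker C a 1 1)"
    unfolding nullity_def
    by (intro fun_dim_mono[OF fun_subspace_ker_mat fun_subspace_image[OF fun_subspace_conv_ker lin_on_head] _
          head_conv_ker_subset fin])
  then show ?case using conv_ker_step[OF fin, of a 0 0] by simp
next
  case (Suc q)
  obtain D where D: "k \<le> fun_dim (head ` conv_ker C a (Suc D) (Suc D + m))"
    using ex_head_ge[OF fin deg k] by blast
  have "head ` conv_ker C a (Suc D) (Suc D + m) \<subseteq> head ` conv_ker C a (Suc (Suc q)) (Suc (Suc q))"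
  proof
    fix x assume "x \<in> head ` conv_ker C a (Suc D) (Suc D + m)"
    then obtain v where v: "v \<in> conv_ker C a (Suc D) (Suc D + m)" "x = head v" by auto
    have conv_coeff: "conv_coeff C a v j r = 0" if "r \<in> C" for j r
    proof (cases "j < Suc D + m")
      case False
      have "a i r c * v (j - i, c) = 0" for i c
        using False deg[of i] v by (cases "m < i") (auto simp: conv_ker_def supported_on_def less_diff_conv2)
      then show ?thesis by (simp add: conv_coeff_def)
    qed (use v that in \<open>auto simp: conv_ker_def\<close>)
    \<comment> \<open>coefficient \<open>j\<close> of a product depends only on coefficients up to \<open>j\<close>, so truncation is harmless\<close>
    define w where "w = (\<lambda>(j, c). if j < Suc (Suc q) then v (j, c) else 0)"
    have "conv_coeff C a w j r = conv_coeff C a v j r" if "j < Suc (Suc q)" for j r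
      unfolding conv_coeff_def w_def using that by (auto intro!: sum.cong)
    then have "w \<in> conv_ker C a (Suc (Suc q)) (Suc (Suc q))"
      using conv_coeff v by (auto simp: conv_ker_def) (auto simp: w_def supported_on_def)
    moreover have "head w = x" using v by (simp add: head_def w_def)
    ultimately show "x \<in> head ` conv_ker C a (Suc (Suc q)) (Suc (Suc q))" by blast
  qed
  then have "k \<le> fun_dim (head ` conv_ker C a (Suc (Suc q)) (Suc (Suc q)))"
    using D
    by (meson fin head_conv_ker_subset le_trans lin_on_head fun_subspace_conv_ker fun_subspace_image fun_dim_mono)
  then show ?case using Suc conv_ker_step[OF fin, of a "Suc q" "Suc q"] by simp
qed

definition block :: "nat \<Rightarrow> (nat \<Rightarrow> 'c \<Rightarrow> 'c \<Rightarrow> 'k::field) \<Rightarrow> nat \<times> 'c \<Rightarrow> nat \<times> 'c \<Rightarrow> 'k" where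
  "block m N = (\<lambda>(\<alpha>, r) (\<beta>, c). if \<alpha> + \<beta> \<le> m then N (\<alpha> + \<beta>) r c else 0)"

text \<open>Row block \<open>\<alpha>\<close> of the matrix computes coefficient \<open>m - \<alpha>\<close> of the product of the vector with the
  reversed matrix polynomial \<open>\<Sum> N\<^bsub>m-i\<^esub> t\<^sup>i\<close>.\<close>

lemma ker_mat_block:
  fixes N :: "nat \<Rightarrow> 'c \<Rightarrow> 'c \<Rightarrow> 'k::field"
  assumes fin: "finite C"
  shows "ker_mat ({..<Suc m} \<times> C) (block m N) =
    conv_ker C (\<lambda>i. if i \<le> m then N (m - i) else (\<lambda>_ _. 0)) (Suc m) (Suc m)"
proof -
  let ?a = "\<lambda>i. if i \<le> m then N (m - i) else (\<lambda>_ _. 0)"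
  have row: "(\<Sum>y\<in>{..<Suc m} \<times> C. block m N (\<alpha>, r) y * v y) = conv_coeff C ?a v (m - \<alpha>) r"
    if "\<alpha> \<le> m" for \<alpha> r and v :: "nat \<times> 'c \<Rightarrow> 'k"
  proof -
    have "(\<Sum>y\<in>{..<Suc m} \<times> C. block m N (\<alpha>, r) y * v y)
        = (\<Sum>\<beta><Suc m. \<Sum>c\<in>C. (if \<alpha> + \<beta> \<le> m then N (\<alpha> + \<beta>) r c else 0) * v (\<beta>, c))"
      unfolding sum.cartesian_product by (rule sum.cong) (auto simp: block_def)
    also have "\<dots> = (\<Sum>\<beta>\<le>m - \<alpha>. \<Sum>c\<in>C. N (\<alpha> + \<beta>) r c * v (\<beta>, c))"
    proof (intro sum.mono_neutral_cong_right ballI)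
      fix \<beta> assume "\<beta> \<in> {..<Suc m} - {..m - \<alpha>}"
      then have "\<not> \<alpha> + \<beta> \<le> m" by auto
      then show "(\<Sum>c\<in>C. (if \<alpha> + \<beta> \<le> m then N (\<alpha> + \<beta>) r c else 0) * v (\<beta>, c)) = 0"
        by simp
    qed (use that fin in \<open>auto intro!: sum.cong\<close>)
    also have "\<dots> = conv_coeff C ?a v (m - \<alpha>) r"
      unfolding conv_coeff_def using that
      by (intro sum.reindex_bij_witness[of _ "\<lambda>i. m - \<alpha> - i" "\<lambda>i. m - \<alpha> - i"]) auto
    finally show ?thesis .
  qed
  have "(\<forall>y\<in>{..<Suc m} \<times> C. (\<Sum>z\<in>{..<Suc m} \<times> C. block m N y z * v z) = 0) \<longleftrightarrow>
      (\<forall>(j, r)\<in>{..<Suc m} \<times> C. conv_coeff C ?a v j r = 0)" for v :: "nat \<times> 'c \<Rightarrow> 'k"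
  proof (intro iffI ballI)
    fix y assume L: "\<forall>y\<in>{..<Suc m} \<times> C. (\<Sum>z\<in>{..<Suc m} \<times> C. block m N y z * v z) = 0"
      and y: "y \<in> {..<Suc m} \<times> C"
    obtain j r where jr: "y = (j, r)" by (cases y)
    have "m - j \<le> m" "m - (m - j) = j" "(m - j, r) \<in> {..<Suc m} \<times> C" using y jr by auto
    then show "case y of (j, r) \<Rightarrow> conv_coeff C ?a v j r = 0"
      using bspec[OF L, of "(m - j, r)"] row[of "m - j" r v] jr by simp
  next
    fix y assume R: "\<forall>(j, r)\<in>{..<Suc m} \<times> C. conv_coeff C ?a v j r = 0" and y: "y \<in> {..<Suc m} \<times> C"
    obtain j r where jr: "y = (j, r)" by (cases y)
    have "(m - j, r) \<in> {..<Suc m} \<times> C" using y jr by auto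
    then show "(\<Sum>z\<in>{..<Suc m} \<times> C. block m N y z * v z) = 0"
      using bspec[OF R, of "(m - j, r)"] row[of j r v] y jr by auto
  qed
  then show ?thesis unfolding ker_mat_def conv_ker_def by blast
qed

theorem nullity_block:
  fixes N :: "nat \<Rightarrow> 'c \<Rightarrow> 'c \<Rightarrow> 'k::field_char_0"
  assumes fin: "finite C"
    and k: "\<And>t. k \<le> nullity C (\<lambda>r c. \<Sum>i\<le>m. N (m - i) r c * t ^ i)"
  shows "nullity ({..<Suc m} \<times> C) (block m N) \<le> Suc m * nullity C (N m)"
    and "m * k + nullity C (N m) \<le> nullity ({..<Suc m} \<times> C) (block m N)"
proof -
  let ?a = "\<lambda>i. if i \<le> m then N (m - i) else (\<lambda>_ _. 0)"
  have n: "nullity ({..<Suc m} \<times> C) (block m N) = fun_dim (conv_ker C ?a (Suc m) (Suc m))"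
    by (simp add: nullity_def ker_mat_block[OF fin])
  show "nullity ({..<Suc m} \<times> C) (block m N) \<le> Suc m * nullity C (N m)"
    using fun_dim_conv_ker_le[OF fin, of ?a "Suc m"] by (simp add: n)
  have "poly_mat m ?a t = (\<lambda>r c. \<Sum>i\<le>m. N (m - i) r c * t ^ i)" for t
    by (auto simp: poly_mat_def fun_eq_iff)
  then show "m * k + nullity C (N m) \<le> nullity ({..<Suc m} \<times> C) (block m N)"
    using fun_dim_conv_ker_ge[OF fin, of m ?a k m] k by (simp add: n)
qed

section \<open>Nullity of block matrices in several variables\<close>

text \<open>If \<open>N \<omega>\<close> is the matrix of the component \<open>f\<^sub>\<omega>\<close> of a form on the tensor product, then this is the matrix
  of the form itself in the basis \<open>b\<^sub>i \<otimes> \<tau>\<^sup>\<alpha>\<close>.\<close>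

definition multi_block :: "(nat \<Rightarrow>\<^sub>0 nat) \<Rightarrow> ((nat \<Rightarrow>\<^sub>0 nat) \<Rightarrow> 'c \<Rightarrow> 'c \<Rightarrow> 'k::field) \<Rightarrow>
    (nat \<Rightarrow>\<^sub>0 nat) \<times> 'c \<Rightarrow> (nat \<Rightarrow>\<^sub>0 nat) \<times> 'c \<Rightarrow> 'k" where
  "multi_block \<mu> N = (\<lambda>(\<alpha>, r) (\<beta>, c). if exp_le (\<alpha> + \<beta>) \<mu> then N (\<alpha> + \<beta>) r c else 0)"

lemma lookup_exponents: "\<omega> \<in> exponents l \<Longrightarrow> l \<le> i \<Longrightarrow> Poly_Mapping.lookup \<omega> i = 0"
  by (force simp: exponents_def in_keys_iff subset_iff)

lemma exponents_0: "exponents 0 = {0}"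
  by (auto simp: exponents_def)

lemma exponents_le_0: "exponents_le 0 0 = {0}"
  by (auto simp: exponents_le_def exponents_0 exp_le_def)

lemma zero_in_exponents_le: "0 \<in> exponents_le l \<mu>"
  by (auto simp: exponents_le_def exponents_def exp_le_def)

lemma single_add_exponents:
  assumes "\<omega> \<in> exponents l"
  shows "\<omega> + Poly_Mapping.single l e \<in> exponents (Suc l)"
  using assms lookup_exponents[OF assms]
  by (auto simp: exponents_def in_keys_iff lookup_add lookup_single when_def subset_iff less_Suc_eq split: if_splits)

lemma exponents_Suc_cases:
  assumes "\<omega> \<in> exponents (Suc l)"
  obtains \<omega>' e where "\<omega>' \<in> exponents l" "\<omega> = \<omega>' + Poly_Mapping.single l e"
proof
  let ?e = "Poly_Mapping.lookup \<omega> l"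
  show "\<omega> = (\<omega> - Poly_Mapping.single l ?e) + Poly_Mapping.single l ?e"
    by (rule poly_mapping_eqI) (auto simp: lookup_add lookup_minus lookup_single when_def)
  show "\<omega> - Poly_Mapping.single l ?e \<in> exponents l"
    using assms
    by (auto simp: exponents_def in_keys_iff lookup_minus lookup_single when_def subset_iff less_Suc_eq split: if_splits)
qed

lemma lookup_split:
  assumes "\<omega> \<in> exponents l"
  shows "Poly_Mapping.lookup (\<omega> + Poly_Mapping.single l e) i =
    (if i = l then e else Poly_Mapping.lookup \<omega> i)"
  using lookup_exponents[OF assms, of l] by (auto simp: lookup_add lookup_single when_def)

lemma exp_le_split:
  assumes "\<omega> \<in> exponents l" "\<mu> \<in> exponents l"
  shows "exp_le (\<omega> + Poly_Mapping.single l e) (\<mu> + Poly_Mapping.single l m) \<longleftrightarrow>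
    exp_le \<omega> \<mu> \<and> e \<le> m"
  unfolding exp_le_def lookup_split[OF assms(1)] lookup_split[OF assms(2)]
proof safe
  fix i assume *: "\<forall>i. (if i = l then e else Poly_Mapping.lookup \<omega> i) \<le> (if i = l then m else Poly_Mapping.lookup \<mu> i)"
  show "Poly_Mapping.lookup \<omega> i \<le> Poly_Mapping.lookup \<mu> i"
    using spec[OF *, of i] lookup_exponents[OF assms(1), of l] by (cases "i = l") auto
  show "e \<le> m" using spec[OF *, of l] by simp
qed simp

lemma exponents_add: "\<alpha> \<in> exponents l \<Longrightarrow> \<beta> \<in> exponents l \<Longrightarrow> \<alpha> + \<beta> \<in> exponents l"
  using keys_add[of \<alpha> \<beta>] by (auto simp: exponents_def)

text \<open>Splitting off the last exponent; it identifies the index set of a block matrix in \<open>l + 1\<close> variables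
  with that of a one-variable block matrix whose blocks are block matrices in \<open>l\<close> variables.\<close>

lemma bij_split:
  fixes C :: "'c set"
  assumes "\<mu> \<in> exponents l"
  shows "bij_betw (\<lambda>(e, \<omega>, c). (\<omega> + Poly_Mapping.single l e, c))
    ({..<Suc m} \<times> (exponents_le l \<mu> \<times> C)) (exponents_le (Suc l) (\<mu> + Poly_Mapping.single l m) \<times> C)"
    (is "bij_betw ?g ?A ?B")
proof (rule bij_betw_imageI)
  show "inj_on ?g ?A"
  proof (rule inj_onI)
    fix x y assume xy: "x \<in> ?A" "y \<in> ?A" "?g x = ?g y"
    obtain e \<omega> c e' \<omega>' c' where x: "x = (e, \<omega>, c)" and y: "y = (e', \<omega>', c')"
      by (metis prod.exhaust)
    have *: "\<omega> \<in> exponents_le l \<mu>" "\<omega>' \<in> exponents_le l \<mu>"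
      "\<omega> + Poly_Mapping.single l e = \<omega>' + Poly_Mapping.single l e'" "c = c'"
      using xy by (auto simp: x y)
    then have E: "\<omega> \<in> exponents l" "\<omega>' \<in> exponents l" by (auto simp: exponents_le_def)
    have eq: "(if i = l then e else Poly_Mapping.lookup \<omega> i) = (if i = l then e' else Poly_Mapping.lookup \<omega>' i)" for i
      using arg_cong[OF *(3), of "\<lambda>x. Poly_Mapping.lookup x i"] by (simp only: lookup_split[OF E(1)] lookup_split[OF E(2)])
    have "\<omega> = \<omega>'"
      using eq lookup_exponents[OF E(1), of l] lookup_exponents[OF E(2), of l]
      by (intro poly_mapping_eqI) (metis order_refl)
    then show "x = y" using eq[of l] *(4) by (simp add: x y)
  qed
  show "?g ` ?A = ?B"
  proof (intro equalityI subsetI)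
    fix y assume "y \<in> ?g ` ?A"
    then show "y \<in> ?B"
      using exp_le_split[OF _ assms] single_add_exponents by (auto simp: exponents_le_def)
  next
    fix y assume "y \<in> ?B"
    then obtain \<omega> c where y: "y = (\<omega>, c)" "c \<in> C" "\<omega> \<in> exponents (Suc l)"
      "exp_le \<omega> (\<mu> + Poly_Mapping.single l m)" by (auto simp: exponents_le_def)
    obtain \<omega>' e where w: "\<omega>' \<in> exponents l" "\<omega> = \<omega>' + Poly_Mapping.single l e"
      using y(3) by (rule exponents_Suc_cases)
    have "(e, \<omega>', c) \<in> ?A" using y(2,4) w(1) exp_le_split[OF w(1) assms] unfolding w(2) by (auto simp: exponents_le_def)
    moreover have "?g (e, \<omega>', c) = y" using w y by simp
    ultimately show "y \<in> ?g ` ?A" by blast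
  qed
qed

lemma finite_exponents_le:
  assumes "\<mu> \<in> exponents l"
  shows "finite (exponents_le l \<mu>)"
  using assms
proof (induction l arbitrary: \<mu>)
  case 0
  then show ?case by (simp add: exponents_0 exponents_le_0)
next
  case (Suc l)
  obtain \<nu> m where \<mu>: "\<nu> \<in> exponents l" "\<mu> = \<nu> + Poly_Mapping.single l m"
    using Suc.prems by (rule exponents_Suc_cases)
  have "finite (exponents_le (Suc l) \<mu> \<times> {()})"
    using bij_betw_finite[OF bij_split[OF \<mu>(1), of m "{()}"]] Suc.IH[OF \<mu>(1)] by (simp add: \<mu>(2))
  then show ?case by (auto simp: finite_cartesian_product_iff)
qed

text \<open>The matrices attached to the linear forms on a Lie algebra form such a space. Closure under linear
  combinations makes every value of a matrix polynomial with coefficients in the space a member of it.\<close>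

definition lin_mats :: "('c \<Rightarrow> 'c \<Rightarrow> 'k::field) set \<Rightarrow> bool" where
  "lin_mats \<M> \<longleftrightarrow> (\<lambda>_ _. 0) \<in> \<M> \<and> (\<forall>M\<in>\<M>. \<forall>N\<in>\<M>. (\<lambda>r c. M r c + N r c) \<in> \<M>) \<and>
     (\<forall>a. \<forall>M\<in>\<M>. (\<lambda>r c. M r c * a) \<in> \<M>)"

lemma lin_mats_add:
  "lin_mats \<M> \<Longrightarrow> M \<in> \<M> \<Longrightarrow> N \<in> \<M> \<Longrightarrow> (\<lambda>r c. M r c + N r c) \<in> \<M>"
  by (auto simp: lin_mats_def)

lemma lin_mats_sum:
  assumes "lin_mats \<M>" "\<And>i. i \<in> I \<Longrightarrow> M i \<in> \<M>"
  shows "(\<lambda>r c. \<Sum>i\<in>I. M i r c * t i) \<in> \<M>"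
  using assms(2)
proof (induction I rule: infinite_finite_induct)
  case (insert i I)
  have "(\<lambda>r c. M i r c * t i) \<in> \<M>" "(\<lambda>r c. \<Sum>i\<in>I. M i r c * t i) \<in> \<M>"
    using insert assms(1) by (auto simp: lin_mats_def)
  then have "(\<lambda>r c. M i r c * t i + (\<Sum>i\<in>I. M i r c * t i)) \<in> \<M>"
    using lin_mats_add[OF assms(1)] by blast
  then show ?case using insert by simp
qed (use assms(1) in \<open>auto simp: lin_mats_def\<close>)

text \<open>Induction on the number of variables. The inner block matrices depend linearly on their entries, so
  by the induction hypothesis every linear combination of them has nullity at least \<open>card W * k\<close>, which is
  the hypothesis of the one-variable result. The lower bound is stated with \<open>k\<close> added on both sides to
  avoid truncated subtraction.\<close>

theorem nullity_multi_block:
  fixes N :: "(nat \<Rightarrow>\<^sub>0 nat) \<Rightarrow> 'c \<Rightarrow> 'c \<Rightarrow> 'k::field_char_0"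
  assumes fin: "finite C" and lin: "lin_mats \<M>" and k: "\<And>M. M \<in> \<M> \<Longrightarrow> k \<le> nullity C M"
    and \<mu>: "\<mu> \<in> exponents l" and N: "\<And>\<omega>. N \<omega> \<in> \<M>"
  shows "nullity (exponents_le l \<mu> \<times> C) (multi_block \<mu> N) \<le> card (exponents_le l \<mu>) * nullity C (N \<mu>) \<and>
    card (exponents_le l \<mu>) * k + nullity C (N \<mu>) \<le> nullity (exponents_le l \<mu> \<times> C) (multi_block \<mu> N) + k"
  using \<mu> N
proof (induction l arbitrary: \<mu> N)
  case 0
  have \<mu>: "\<mu> = 0" using 0 by (simp add: exponents_0)
  have "bij_betw (\<lambda>(_, c). c) ({0 :: nat \<Rightarrow>\<^sub>0 nat} \<times> C) C"
    by (rule bij_betwI[of _ _ _ "\<lambda>c. (0, c)"]) auto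
  then have "nullity ({0} \<times> C) (multi_block 0 N) = nullity C (N 0)"
    using fin by (intro nullity_reindex) (auto simp: multi_block_def exp_le_def)
  then show ?case by (simp add: \<mu> exponents_le_0)
next
  case (Suc l)
  obtain \<nu> m where \<mu>: "\<nu> \<in> exponents l" "\<mu> = \<nu> + Poly_Mapping.single l m"
    using Suc.prems(1) by (rule exponents_Suc_cases)
  let ?W = "exponents_le l \<nu>" and ?W' = "exponents_le (Suc l) \<mu>"
  \<comment> \<open>\<open>B e\<close> is the block matrix of the components whose last exponent is \<open>e\<close>\<close>
  define B where "B = (\<lambda>e. multi_block \<nu> (\<lambda>\<omega>. N (\<omega> + Poly_Mapping.single l e)))"
  note IH = Suc.IH[OF \<mu>(1)]
  have finW: "finite ?W" and finW': "finite ?W'"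
    using finite_exponents_le \<mu>(1) Suc.prems(1) by blast+
  have W0: "card ?W > 0" using finW zero_in_exponents_le[of l \<nu>] by (auto simp: card_gt_0_iff)
  have bij: "bij_betw (\<lambda>(e, \<omega>, c). (\<omega> + Poly_Mapping.single l e, c)) ({..<Suc m} \<times> (?W \<times> D)) (?W' \<times> D)"
    for D :: "'d set"
    unfolding \<mu>(2) by (rule bij_split[OF \<mu>(1)])
  have card: "card ?W' = Suc m * card ?W"
    using bij_betw_same_card[OF bij[of "{()}"]] by (simp add: card_cartesian_product)
  have "nullity ({..<Suc m} \<times> (?W \<times> C)) (block m B) = nullity (?W' \<times> C) (multi_block \<mu> N)"
  proof (rule nullity_reindex[OF _ bij])
    fix x y assume xy: "x \<in> {..<Suc m} \<times> (?W \<times> C)" "y \<in> {..<Suc m} \<times> (?W \<times> C)"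
    obtain e \<alpha> r e' \<beta> c where e: "x = (e, \<alpha>, r)" "y = (e', \<beta>, c)" by (metis prod.exhaust)
    have ab: "\<alpha> + \<beta> \<in> exponents l" using xy e by (auto simp: exponents_le_def intro: exponents_add)
    have "(\<alpha> + Poly_Mapping.single l e) + (\<beta> + Poly_Mapping.single l e') = \<alpha> + \<beta> + Poly_Mapping.single l (e + e')"
      by (simp add: single_add algebra_simps)
    then show "block m B x y = multi_block \<mu> N (case x of (e, \<omega>, c) \<Rightarrow> (\<omega> + Poly_Mapping.single l e, c))
        (case y of (e, \<omega>, c) \<Rightarrow> (\<omega> + Poly_Mapping.single l e, c))"
      unfolding e \<mu>(2) using exp_le_split[OF ab \<mu>(1), of "e + e'" m]
      by (simp add: block_def B_def multi_block_def)
  qed (use fin finW' in auto)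
  moreover have low: "card ?W * k \<le> nullity (?W \<times> C) (\<lambda>r c. \<Sum>i\<le>m. B (m - i) r c * t ^ i)" for t
  proof -
    let ?N = "\<lambda>\<omega> r c. \<Sum>i\<le>m. N (\<omega> + Poly_Mapping.single l (m - i)) r c * t ^ i"
    have N': "?N \<omega> \<in> \<M>" for \<omega> by (rule lin_mats_sum[OF lin Suc.prems(2)])
    have "(\<lambda>r c. \<Sum>i\<le>m. B (m - i) r c * t ^ i) = multi_block \<nu> ?N"
      by (auto simp: B_def multi_block_def fun_eq_iff)
    then show ?thesis using IH[of ?N] N' k[OF N'[of \<nu>]] by force
  qed
  moreover have B: "nullity (?W \<times> C) (B m) \<le> card ?W * nullity C (N \<mu>)"
    "card ?W * k + nullity C (N \<mu>) \<le> nullity (?W \<times> C) (B m) + k"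
    using IH[of "\<lambda>\<omega>. N (\<omega> + Poly_Mapping.single l m)"] Suc.prems(2) by (auto simp: B_def \<mu>(2))
  ultimately have "nullity (?W' \<times> C) (multi_block \<mu> N) \<le> Suc m * nullity (?W \<times> C) (B m)"
    "m * (card ?W * k) + nullity (?W \<times> C) (B m) \<le> nullity (?W' \<times> C) (multi_block \<mu> N)"
    using nullity_block[where C = "?W \<times> C" and k = "card ?W * k" and m = m and N = B] fin finW by auto
  moreover have "Suc m * nullity (?W \<times> C) (B m) \<le> card ?W' * nullity C (N \<mu>)"
    using mult_le_mono2[OF B(1), of "Suc m"] by (simp add: card algebra_simps)
  moreover have "card ?W' * k = m * (card ?W * k) + card ?W * k"
    by (simp add: card algebra_simps)
  ultimately show ?case using B(2) by linarith
qed

section \<open>Coordinates on vector spaces and stabilizers\<close>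

lemma linear_forms_iff:
  "f \<in> linear_forms class_ring V \<longleftrightarrow>
    (\<forall>x\<in>carrier V. \<forall>y\<in>carrier V. f (x \<oplus>\<^bsub>V\<^esub> y) = f x + f y) \<and>
    (\<forall>a. \<forall>x\<in>carrier V. f (a \<odot>\<^bsub>V\<^esub> x) = a * (f x :: 'k::field))"
  by (auto simp: linear_forms_def LinearCombinations.module_hom_def scalar_module_def)

text \<open>A vector space given through coordinates: \<open>\<phi>\<close> is a linear bijection onto the functions supported on
  the finite set \<open>C\<close>, and \<open>b\<close> is the basis with respect to which \<open>\<phi>\<close> reads off coefficients. The axioms of
  a vector space follow.\<close>

locale coord_space =
  fixes V :: "('k::field, 'v, 'n) module_scheme" and \<phi> :: "'v \<Rightarrow> 'c \<Rightarrow> 'k" and C :: "'c set"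
    and b :: "'c \<Rightarrow> 'v"
  assumes zero: "\<zero>\<^bsub>V\<^esub> \<in> carrier V" "\<phi> \<zero>\<^bsub>V\<^esub> = (\<lambda>_. 0)"
    and add: "\<And>x y. x \<in> carrier V \<Longrightarrow> y \<in> carrier V \<Longrightarrow>
      x \<oplus>\<^bsub>V\<^esub> y \<in> carrier V \<and> \<phi> (x \<oplus>\<^bsub>V\<^esub> y) = (\<lambda>c. \<phi> x c + \<phi> y c)"
    and smult: "\<And>a x. x \<in> carrier V \<Longrightarrow>
      a \<odot>\<^bsub>V\<^esub> x \<in> carrier V \<and> \<phi> (a \<odot>\<^bsub>V\<^esub> x) = (\<lambda>c. a * \<phi> x c)"
    and inj: "inj_on \<phi> (carrier V)"
    and img: "\<phi> ` carrier V = supported_on C"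
    and finC: "finite C"
    and b: "\<And>c. c \<in> C \<Longrightarrow> b c \<in> carrier V"
      "\<And>c. c \<in> C \<Longrightarrow> \<phi> (b c) = (\<lambda>d. if d = c then 1 else 0)"
begin

lemma coords_outside: "x \<in> carrier V \<Longrightarrow> c \<notin> C \<Longrightarrow> \<phi> x c = 0"
  using img by (auto simp: supported_on_def)

lemma dim_eq_card: "vectorspace.dim class_ring V = card C"
  using dim_via_coordinates[OF zero add smult inj _ finC] img by (simp add: supported_on_fin_dim(2)[OF finC])

lemma eqI: "x \<in> carrier V \<Longrightarrow> y \<in> carrier V \<Longrightarrow> \<phi> x = \<phi> y \<Longrightarrow> x = y"
  using inj by (auto dest: inj_onD)

lemma subspace_dim:
  assumes "S \<subseteq> carrier V" "fun_subspace (\<phi> ` S)"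
  shows "vectorspace.dim class_ring (V\<lparr>carrier := S\<rparr>) = fun_dim (\<phi> ` S)"
proof -
  have mem: "x \<in> S" if "x \<in> carrier V" "\<phi> x \<in> \<phi> ` S" for x
    using that assms(1) inj by (auto simp: inj_on_image_mem_iff)
  show ?thesis
  proof (rule dim_via_coordinates[where M = "V\<lparr>carrier := S\<rparr>" and \<phi> = \<phi> and C = C, simplified])
    show "\<zero>\<^bsub>V\<^esub> \<in> S" using mem zero fun_subspaceD(1)[OF assms(2)] by simp
    show "x \<oplus>\<^bsub>V\<^esub> y \<in> S \<and> \<phi> (x \<oplus>\<^bsub>V\<^esub> y) = (\<lambda>c. \<phi> x c + \<phi> y c)" if "x \<in> S" "y \<in> S" for x y
    proof -
      have xy: "x \<in> carrier V" "y \<in> carrier V" using that assms(1) by auto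
      show ?thesis
        using mem[of "x \<oplus>\<^bsub>V\<^esub> y"] add[OF xy] fun_subspaceD(2)[OF assms(2) imageI[OF that(1)] imageI[OF that(2)]]
        by simp
    qed
    show "a \<odot>\<^bsub>V\<^esub> x \<in> S \<and> \<phi> (a \<odot>\<^bsub>V\<^esub> x) = (\<lambda>c. a * \<phi> x c)" if "x \<in> S" for a x
    proof -
      have x: "x \<in> carrier V" using that assms(1) by auto
      show ?thesis
        using mem[of "a \<odot>\<^bsub>V\<^esub> x"] smult[OF x] fun_subspaceD(3)[OF assms(2) imageI[OF that]] by simp
    qed
    show "inj_on \<phi> S" using inj assms(1) by (rule inj_on_subset)
    show "\<phi> ` S \<subseteq> supported_on C" using img assms(1) by blast
  qed (use zero finC in auto)
qed

text \<open>Induction along the expansion in the basis, for properties that are not values of linear forms, such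
  as membership in a span of relations.\<close>

lemma coord_induct:
  assumes x: "x \<in> carrier V"
    and P_zero: "P \<zero>\<^bsub>V\<^esub>"
    and P_add: "\<And>x y. x \<in> carrier V \<Longrightarrow> y \<in> carrier V \<Longrightarrow> P x \<Longrightarrow> P y \<Longrightarrow> P (x \<oplus>\<^bsub>V\<^esub> y)"
    and P_smult: "\<And>a c. c \<in> C \<Longrightarrow> P (a \<odot>\<^bsub>V\<^esub> b c)"
  shows "P x"
proof -
  have "P x" if "finite D" "D \<subseteq> C" "\<phi> x \<in> supported_on D" "x \<in> carrier V" for D x
    using that
  proof (induction D arbitrary: x rule: finite_induct)
    case empty
    then have "x = \<zero>\<^bsub>V\<^esub>" using zero by (intro eqI) (auto simp: supported_on_def)
    then show ?case using P_zero by simp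
  next
    case (insert d D)
    have bd: "a \<odot>\<^bsub>V\<^esub> b d \<in> carrier V" "\<phi> (a \<odot>\<^bsub>V\<^esub> b d) = (\<lambda>c. if c = d then a else 0)" for a
      using smult[of "b d" a] b[of d] insert by auto
    \<comment> \<open>subtract the component along \<open>b d\<close>\<close>
    define y where "y = x \<oplus>\<^bsub>V\<^esub> (- \<phi> x d) \<odot>\<^bsub>V\<^esub> b d"
    have y: "y \<in> carrier V" "\<phi> y = (\<lambda>c. if c = d then 0 else \<phi> x c)"
      using add[of x "(- \<phi> x d) \<odot>\<^bsub>V\<^esub> b d"] bd insert by (auto simp: y_def)
    have "x = y \<oplus>\<^bsub>V\<^esub> \<phi> x d \<odot>\<^bsub>V\<^esub> b d"
      using add[OF y(1) bd(1)] insert.prems by (intro eqI) (auto simp: y bd)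
    moreover have "P y" using insert y by (intro insert.IH) (auto simp: supported_on_def)
    ultimately show ?case using P_add[OF y(1) bd(1)] P_smult insert.prems by (metis insert_subset)
  qed
  then show ?thesis using img x finC by blast
qed

lemma sum_coords_basis:
  "d \<in> C \<Longrightarrow> (\<Sum>c\<in>C. \<phi> (b d) c * t c) = t d"
  using finC b(2)[of d] by (simp add: if_distrib[of "\<lambda>z. z * _"] cong: if_cong)

lemma linear_form_expand:
  assumes f: "f \<in> linear_forms class_ring V" and x: "x \<in> carrier V"
  shows "f x = (\<Sum>c\<in>C. \<phi> x c * f (b c))"
  using x
proof (rule coord_induct)
  have "f (0 \<odot>\<^bsub>V\<^esub> \<zero>\<^bsub>V\<^esub>) = 0 * f \<zero>\<^bsub>V\<^esub>"
    using f zero by (simp add: linear_forms_iff)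
  moreover have "0 \<odot>\<^bsub>V\<^esub> \<zero>\<^bsub>V\<^esub> = \<zero>\<^bsub>V\<^esub>"
    using smult[OF zero(1), of 0] zero by (intro eqI) auto
  ultimately show "f \<zero>\<^bsub>V\<^esub> = (\<Sum>c\<in>C. \<phi> \<zero>\<^bsub>V\<^esub> c * f (b c))" by (simp add: zero)
next
  fix x y assume "x \<in> carrier V" "y \<in> carrier V"
    "f x = (\<Sum>c\<in>C. \<phi> x c * f (b c))" "f y = (\<Sum>c\<in>C. \<phi> y c * f (b c))"
  then show "f (x \<oplus>\<^bsub>V\<^esub> y) = (\<Sum>c\<in>C. \<phi> (x \<oplus>\<^bsub>V\<^esub> y) c * f (b c))"
    using f add by (simp add: linear_forms_iff sum.distrib algebra_simps)
next
  fix a c assume c: "c \<in> C"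
  then show "f (a \<odot>\<^bsub>V\<^esub> b c) = (\<Sum>d\<in>C. \<phi> (a \<odot>\<^bsub>V\<^esub> b c) d * f (b d))"
    using f smult[OF b(1)[OF c], of a] b(1)[OF c] sum_coords_basis[OF c, of "\<lambda>d. f (b d)"]
    by (simp add: linear_forms_iff mult.assoc flip: sum_distrib_left)
qed

lemma linear_form_of_values:
  "(\<lambda>x. \<Sum>c\<in>C. \<phi> x c * t c) \<in> linear_forms class_ring V"
  using add smult by (auto simp: linear_forms_iff sum.distrib sum_distrib_left algebra_simps)

lemma dual_basis_form_eq:
  assumes "i \<in> C" "x \<in> carrier V"
  shows "dual_basis_form class_ring V C b i x = \<phi> x i"
proof -
  let ?P = "\<lambda>e. e \<in> linear_forms class_ring V \<and> e \<in> extensional (carrier V) \<and>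
    (\<forall>j\<in>C. e (b j) = (if j = i then 1 else 0))"
  let ?e = "restrict (\<lambda>x. \<phi> x i) (carrier V)"
  have "?P ?e"
    using add smult b assms by (auto simp: linear_forms_iff)
  moreover have "e = ?e" if e: "?P e" for e
  proof (rule extensionalityI[of _ "carrier V"])
    fix x assume x: "x \<in> carrier V"
    have "e x = (\<Sum>c\<in>C. \<phi> x c * e (b c))" using e x by (intro linear_form_expand) auto
    also have "\<dots> = (\<Sum>c\<in>C. if c = i then \<phi> x c else 0)" using e by (intro sum.cong) auto
    also have "\<dots> = ?e x" using finC assms x by simp
    finally show "e x = ?e x" .
  qed (use e in auto)
  ultimately have "dual_basis_form class_ring V C b i = ?e"
    unfolding dual_basis_form_def by (intro the_equality) simp_all
  then show ?thesis using assms by simp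
qed

text \<open>Bilinearity, expressed by the structure constants of the operation in the basis \<open>b\<close>. It applies
  alike to brackets and to the multiplication of the coefficient algebra.\<close>

definition bilinear_op :: "('v \<Rightarrow> 'v \<Rightarrow> 'v) \<Rightarrow> bool" where
  "bilinear_op m \<longleftrightarrow> (\<forall>x\<in>carrier V. \<forall>y\<in>carrier V. m x y \<in> carrier V \<and>
     (\<forall>c. \<phi> (m x y) c = (\<Sum>d\<in>C. \<Sum>e\<in>C. \<phi> x d * \<phi> y e * \<phi> (m (b d) (b e)) c)))"

lemma bilinear_op_linear_form:
  assumes m: "bilinear_op m" and f: "f \<in> linear_forms class_ring V"
    and x: "x \<in> carrier V" and y: "y \<in> carrier V"
  shows "f (m x y) = (\<Sum>d\<in>C. \<Sum>e\<in>C. \<phi> x d * \<phi> y e * f (m (b d) (b e)))"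
proof -
  have "f (m x y) = (\<Sum>c\<in>C. \<Sum>d\<in>C. \<Sum>e\<in>C. \<phi> x d * \<phi> y e * (\<phi> (m (b d) (b e)) c * f (b c)))"
    using m x y linear_form_expand[OF f, of "m x y"]
    by (simp add: bilinear_op_def sum_distrib_right mult.assoc)
  also have "\<dots> = (\<Sum>d\<in>C. \<Sum>e\<in>C. \<Sum>c\<in>C. \<phi> x d * \<phi> y e * (\<phi> (m (b d) (b e)) c * f (b c)))"
    by (rule trans[OF sum.swap sum.cong[OF refl sum.swap]])
  also have "\<dots> = (\<Sum>d\<in>C. \<Sum>e\<in>C. \<phi> x d * \<phi> y e * f (m (b d) (b e)))"
  proof (intro sum.cong refl)
    fix d e assume "d \<in> C" "e \<in> C"
    then have "m (b d) (b e) \<in> carrier V" using m b by (auto simp: bilinear_op_def)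
    then show "(\<Sum>c\<in>C. \<phi> x d * \<phi> y e * (\<phi> (m (b d) (b e)) c * f (b c))) =
        \<phi> x d * \<phi> y e * f (m (b d) (b e))"
      using linear_form_expand[OF f] by (simp add: sum_distrib_left)
  qed
  finally show ?thesis .
qed

lemma bilinear_opI:
  assumes closed: "\<And>x y. x \<in> carrier V \<Longrightarrow> y \<in> carrier V \<Longrightarrow> m x y \<in> carrier V"
    and left: "\<And>y c. y \<in> carrier V \<Longrightarrow> (\<lambda>x. \<phi> (m x y) c) \<in> linear_forms class_ring V"
    and right: "\<And>x c. x \<in> carrier V \<Longrightarrow> (\<lambda>y. \<phi> (m x y) c) \<in> linear_forms class_ring V"
  shows "bilinear_op m"
  unfolding bilinear_op_def
proof (intro ballI conjI allI closed)
  fix x y c assume x: "x \<in> carrier V" and y: "y \<in> carrier V"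
  have "\<phi> (m x y) c = (\<Sum>d\<in>C. \<phi> x d * \<phi> (m (b d) y) c)"
    by (rule linear_form_expand[OF left[OF y] x])
  also have "\<dots> = (\<Sum>d\<in>C. \<phi> x d * (\<Sum>e\<in>C. \<phi> y e * \<phi> (m (b d) (b e)) c))"
    by (intro sum.cong refl arg_cong[where f = "\<lambda>z. _ * z"] linear_form_expand[OF right[OF b(1)] y])
  finally show "\<phi> (m x y) c = (\<Sum>d\<in>C. \<Sum>e\<in>C. \<phi> x d * \<phi> y e * \<phi> (m (b d) (b e)) c)"
    by (simp add: sum_distrib_left mult.assoc)
qed

end

text \<open>A vector is in the stabilizer as soon as it pairs to zero with the basis vectors, which is a system of
  linear equations in its coordinates.\<close>

lemma stabilizer_dim_eq_nullity:
  fixes L :: "('k::field, 'g, 'n) lie_alg_scheme" and b :: "'c \<Rightarrow> 'g"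
  assumes "coord_space L \<phi> C b" and m: "coord_space.bilinear_op L \<phi> C b (bracket L)"
    and f: "f \<in> linear_forms class_ring L"
  shows "stabilizer_dim class_ring L f = nullity C (\<lambda>j k. f (bracket L (b j) (b k)))"
proof -
  interpret coord_space L \<phi> C b by fact
  let ?N = "\<lambda>j k. f (bracket L (b j) (b k))"
  have expand: "f (bracket L y x) = (\<Sum>j\<in>C. \<phi> y j * (\<Sum>k\<in>C. ?N j k * \<phi> x k))"
    if "x \<in> carrier L" "y \<in> carrier L" for x y
    using bilinear_op_linear_form[OF m f that(2,1)] by (simp add: sum_distrib_left algebra_simps)
  have expand_b: "f (bracket L (b j) x) = (\<Sum>k\<in>C. ?N j k * \<phi> x k)" if "j \<in> C" "x \<in> carrier L" for j x
    using expand[OF that(2) b(1)[OF that(1)]] sum_coords_basis[OF that(1)] by simp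
  have stab: "x \<in> form_stabilizer class_ring L f \<longleftrightarrow> \<phi> x \<in> ker_mat C ?N" if x: "x \<in> carrier L" for x
  proof
    assume "x \<in> form_stabilizer class_ring L f"
    then have "(\<Sum>k\<in>C. ?N j k * \<phi> x k) = 0" if "j \<in> C" for j
      using expand_b[OF that x] b(1)[OF that] by (simp add: form_stabilizer_def)
    then show "\<phi> x \<in> ker_mat C ?N" using x img by (auto simp: ker_mat_def)
  next
    assume "\<phi> x \<in> ker_mat C ?N"
    then show "x \<in> form_stabilizer class_ring L f"
      using x expand[OF x] by (simp add: form_stabilizer_def ker_mat_def)
  qed
  have sub: "form_stabilizer class_ring L f \<subseteq> carrier L" by (auto simp: form_stabilizer_def)
  have im: "\<phi> ` form_stabilizer class_ring L f = ker_mat C ?N"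
  proof (intro equalityI subsetI)
    fix y assume y: "y \<in> ker_mat C ?N"
    then obtain x where "x \<in> carrier L" "y = \<phi> x"
      using img ker_mat_subset[of C ?N] by blast
    then show "y \<in> \<phi> ` form_stabilizer class_ring L f" using stab y by auto
  qed (use stab sub in auto)
  show ?thesis
    unfolding stabilizer_dim_def nullity_def im[symmetric]
    by (rule subspace_dim[OF sub]) (simp add: im fun_subspace_ker_mat)
qed

lemma ex_coord_space:
  fixes V :: "('k::field, 'v, 'n) module_scheme"
  assumes "vectorspace class_ring V" "vectorspace.fin_dim class_ring V"
  obtains \<phi> and B where "coord_space V \<phi> B (\<lambda>v. v)"
proof -
  interpret vectorspace class_ring V by fact
  obtain B where B: "finite B" "basis B" using finite_basis_exists[OF assms(2)] by blast
  have BV: "B \<subseteq> carrier V" using B(2) by (simp add: basis_def)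
  have ex1: "\<exists>!a. a \<in> B \<rightarrow>\<^sub>E UNIV \<and> lincomb a B = v" if "v \<in> carrier V" for v
    using basis_criterion[OF B(1) BV] B(2) that by simp
  define cf where "cf = (\<lambda>v. THE a. a \<in> B \<rightarrow>\<^sub>E UNIV \<and> lincomb a B = v)"
  define \<phi> where "\<phi> = (\<lambda>v c. if c \<in> B then cf v c else 0)"
  have lc: "lincomb (\<phi> v) B = v" if "v \<in> carrier V" for v
  proof -
    have "lincomb (\<phi> v) B = lincomb (cf v) B"
      by (rule lincomb_cong) (use BV B in \<open>auto simp: \<phi>_def\<close>)
    then show ?thesis using theI'[OF ex1[OF that]] by (simp add: cf_def)
  qed
  have uniq: "\<phi> v = a" if "a \<in> supported_on B" "lincomb a B = v" "v \<in> carrier V" for v a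
  proof -
    have "lincomb (restrict a B) B = lincomb a B"
      by (rule lincomb_cong) (use BV B in auto)
    then have "cf v = restrict a B"
      unfolding cf_def using ex1[OF that(3)] that by (intro the1_equality) auto
    then show ?thesis using that(1) by (auto simp: \<phi>_def supported_on_def fun_eq_iff)
  qed
  have supp: "\<phi> v \<in> supported_on B" for v by (auto simp: \<phi>_def supported_on_def)
  have "coord_space V \<phi> B (\<lambda>v. v)"
  proof
    show "\<zero>\<^bsub>V\<^esub> \<in> carrier V" by simp
    show "\<phi> \<zero>\<^bsub>V\<^esub> = (\<lambda>_. 0)"
      by (rule uniq) (use lincomb_zero[OF BV, of "\<lambda>_. 0"] in \<open>auto simp: supported_on_def\<close>)
    show "x \<oplus>\<^bsub>V\<^esub> y \<in> carrier V \<and> \<phi> (x \<oplus>\<^bsub>V\<^esub> y) = (\<lambda>c. \<phi> x c + \<phi> y c)"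
      if "x \<in> carrier V" "y \<in> carrier V" for x y
      using that lincomb_sum[OF B(1) BV, of "\<phi> x" "\<phi> y"] supp[of x] supp[of y]
      by (auto intro!: uniq simp: lc) (auto simp: supported_on_def)
    show "a \<odot>\<^bsub>V\<^esub> x \<in> carrier V \<and> \<phi> (a \<odot>\<^bsub>V\<^esub> x) = (\<lambda>c. a * \<phi> x c)"
      if "x \<in> carrier V" for a x
      using that lincomb_smult[OF BV, of "\<phi> x" a] supp[of x]
      by (auto intro!: uniq simp: lc) (auto simp: supported_on_def)
    show "inj_on \<phi> (carrier V)" by (metis inj_onI lc)
    show "\<phi> ` carrier V = supported_on B"
    proof (intro equalityI subsetI)
      fix a :: "'v \<Rightarrow> 'k" assume a: "a \<in> supported_on B"
      have "lincomb a B \<in> carrier V" using BV by (intro lincomb_closed) auto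
      then show "a \<in> \<phi> ` carrier V" using uniq[OF a refl] by (metis imageI)
    qed (use supp in auto)
    show "finite B" by fact
    fix c assume c: "c \<in> B"
    show "c \<in> carrier V" using c BV by auto
    have "lincomb (\<lambda>d. if d = c then 1 else 0) B = c"
    proof -
      have "lincomb (\<lambda>d. if d = c then 1 else 0) B = (\<Oplus>\<^bsub>V\<^esub>v\<in>B. if v = c then v else \<zero>\<^bsub>V\<^esub>)"
        unfolding lincomb_def
      proof (rule finsum_cong')
        fix v assume "v \<in> B"
        then show "(if v = c then 1 else 0) \<odot>\<^bsub>V\<^esub> v = (if v = c then v else \<zero>\<^bsub>V\<^esub>)"
          using BV smult_one[of v] lmult_0[of v] by auto
      qed (use BV in auto)
      then show ?thesis
        using add.finprod_singleton_swap[of c B "\<lambda>v. v"] B BV c by auto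
    qed
    then show "\<phi> c = (\<lambda>d. if d = c then 1 else 0)"
      using c BV by (intro uniq) (auto simp: supported_on_def)
  qed
  then show ?thesis by (rule that)
qed

section \<open>Quotients of modules of finitely supported functions\<close>

text \<open>The linear extension of \<open>g\<close> from the basis \<open>'s\<close> to all finitely supported functions; the second
  index is the coordinate of the value.\<close>

definition weighted_sum :: "('s \<Rightarrow> 'c \<Rightarrow> 'k::field) \<Rightarrow> ('s \<Rightarrow>\<^sub>0 'k) \<Rightarrow> 'c \<Rightarrow> 'k" where
  "weighted_sum g p c = (\<Sum>s\<in>Poly_Mapping.keys p. Poly_Mapping.lookup p s * g s c)"

lemma weighted_sum_superset:
  assumes "finite A" "Poly_Mapping.keys p \<subseteq> A"
  shows "weighted_sum g p c = (\<Sum>s\<in>A. Poly_Mapping.lookup p s * g s c)"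
  unfolding weighted_sum_def using assms by (intro sum.mono_neutral_left) (auto simp: in_keys_iff)

lemma lookup_scale [simp]:
  "Poly_Mapping.lookup (Poly_Mapping.map ((*) a) p) s = a * (Poly_Mapping.lookup p s :: 'k::field)"
  by (simp add: Poly_Mapping.map.rep_eq when_def)

lemma keys_scale: "Poly_Mapping.keys (Poly_Mapping.map ((*) (a::'k::field)) p) \<subseteq> Poly_Mapping.keys p"
  by (auto simp: in_keys_iff)

lemma weighted_sum_add: "weighted_sum g (p + q) c = weighted_sum g p c + weighted_sum g q c"
  using keys_add[of p q]
  by (simp add: weighted_sum_superset[of "Poly_Mapping.keys p \<union> Poly_Mapping.keys q"] lookup_add
      sum.distrib algebra_simps)

lemma weighted_sum_scale: "weighted_sum g (Poly_Mapping.map ((*) a) p) c = a * weighted_sum g p c"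
  using keys_scale[of a p]
  by (simp add: weighted_sum_superset[of "Poly_Mapping.keys p"] sum_distrib_left algebra_simps)

lemma weighted_sum_zero: "weighted_sum g 0 c = 0"
  by (simp add: weighted_sum_def)

lemma weighted_sum_uminus: "weighted_sum g (- p) c = - weighted_sum g p c"
  using weighted_sum_add[of g p "-p" c] by (simp add: weighted_sum_zero add_eq_0_iff)

lemma weighted_sum_diff: "weighted_sum g (p - q) c = weighted_sum g p c - weighted_sum g q c"
  using weighted_sum_add[of g p "-q" c] by (simp add: weighted_sum_uminus)

lemma weighted_sum_single: "weighted_sum g (Poly_Mapping.single s a) c = a * g s c"
  by (simp add: weighted_sum_def)

lemma weighted_sum_sum: "weighted_sum g (\<Sum>i\<in>I. p i) c = (\<Sum>i\<in>I. weighted_sum g (p i) c)"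
  by (induction I rule: infinite_finite_induct) (auto simp: weighted_sum_zero weighted_sum_add)

text \<open>The polynomial algebra and the free module on pairs have the same underlying module structure.\<close>

locale finsupp_module =
  fixes M :: "('k::field, 's \<Rightarrow>\<^sub>0 'k, 'n) module_scheme" and S :: "'s set"
  assumes M_carrier: "carrier M = {p. Poly_Mapping.keys p \<subseteq> S}"
    and M_zero: "zero M = 0" and M_add: "add M = (+)"
    and M_smult: "smult M = (\<lambda>c. Poly_Mapping.map ((*) c))"
begin

lemma M_add_closed: "p \<in> carrier M \<Longrightarrow> q \<in> carrier M \<Longrightarrow> p + q \<in> carrier M"
  using keys_add[of p q] by (auto simp: M_carrier)

lemma M_scale_closed: "p \<in> carrier M \<Longrightarrow> Poly_Mapping.map ((*) a) p \<in> carrier M"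
  using keys_scale[of a p] by (auto simp: M_carrier)

lemma M_uminus_closed: "p \<in> carrier M \<Longrightarrow> - p \<in> carrier M"
  by (simp add: M_carrier)

lemma M_zero_closed: "0 \<in> carrier M"
  by (simp add: M_carrier)

lemma M_diff_closed: "p \<in> carrier M \<Longrightarrow> q \<in> carrier M \<Longrightarrow> p - q \<in> carrier M"
  using M_add_closed[of p "-q"] M_uminus_closed by simp

lemma M_single_closed: "s \<in> S \<Longrightarrow> Poly_Mapping.single s a \<in> carrier M"
  by (auto simp: M_carrier)

lemma vs_M: "vectorspace class_ring M"
proof (rule vs_criteria)
  show "\<forall>v\<in>carrier M. \<exists>w\<in>carrier M. v \<oplus>\<^bsub>M\<^esub> w = \<zero>\<^bsub>M\<^esub>"
    using M_uminus_closed by (force simp: M_add M_zero)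
qed (auto simp: class_field M_zero M_add M_smult M_add_closed M_scale_closed M_zero_closed lookup_add algebra_simps
      intro!: poly_mapping_eqI)

lemma span_submodule:
  assumes "R \<subseteq> carrier M"
  shows "LinearCombinations.submodule class_ring (LinearCombinations.module.span class_ring M R) M"
proof -
  interpret vectorspace class_ring M by (rule vs_M)
  show ?thesis using assms by (rule span_is_submodule)
qed

end

text \<open>A presentation by generators \<open>S\<close> and relations \<open>R\<close> for which a basis of normal forms \<open>nf c\<close> is known: \<open>g\<close>
  gives the coordinates of a generator, it respects the relations, and modulo the relations each
  generator reduces to the combination of normal forms with these coordinates.\<close>

locale finsupp_quotient = finsupp_module M S
  for M :: "('k::field, 's \<Rightarrow>\<^sub>0 'k, 'n) module_scheme" and S :: "'s set" +
  fixes g :: "'s \<Rightarrow> 'c \<Rightarrow> 'k" and R :: "('s \<Rightarrow>\<^sub>0 'k) set" and C :: "'c set" and nf :: "'c \<Rightarrow> 's"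
  assumes finC: "finite C"
    and g_supp: "\<And>s c. s \<in> S \<Longrightarrow> c \<notin> C \<Longrightarrow> g s c = 0"
    and nf_S: "\<And>c. c \<in> C \<Longrightarrow> nf c \<in> S"
    and g_nf: "\<And>c d. c \<in> C \<Longrightarrow> d \<in> C \<Longrightarrow> g (nf c) d = (if d = c then 1 else 0)"
    and R_carrier: "R \<subseteq> carrier M"
    and R_zero: "\<And>r c. r \<in> R \<Longrightarrow> weighted_sum g r c = 0"
    and reduce: "\<And>s. s \<in> S \<Longrightarrow> Poly_Mapping.single s 1 - (\<Sum>c\<in>C. Poly_Mapping.single (nf c) (g s c))
      \<in> LinearCombinations.module.span class_ring M R"
begin

abbreviation N :: "('s \<Rightarrow>\<^sub>0 'k) set" where
  "N \<equiv> LinearCombinations.module.span class_ring M R"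

lemma N_add: "p \<in> N \<Longrightarrow> q \<in> N \<Longrightarrow> p + q \<in> N"
  and N_scale: "p \<in> N \<Longrightarrow> Poly_Mapping.map ((*) a) p \<in> N"
  and N_zero: "0 \<in> N" and N_carrier: "N \<subseteq> carrier M"
  using span_submodule[OF R_carrier]
  by (auto simp: LinearCombinations.submodule_def M_add M_smult M_zero)

lemma N_sum: "(\<And>i. i \<in> I \<Longrightarrow> p i \<in> N) \<Longrightarrow> (\<Sum>i\<in>I. p i) \<in> N"
  by (induction I rule: infinite_finite_induct) (auto simp: N_zero N_add)

text \<open>Since each generator reduces to normal forms, an element is congruent to the combination of normal
  forms given by its coordinates, hence lies in the span of the relations if they vanish.\<close>

lemma span_eq_kernel: "N = {p \<in> carrier M. \<forall>c. weighted_sum g p c = 0}"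
proof (intro equalityI)
  interpret vectorspace class_ring M by (rule vs_M)
  have "submodule class_ring {p \<in> carrier M. \<forall>c. weighted_sum g p c = 0} M"
    using module_axioms
    by (auto simp: LinearCombinations.submodule_def M_add M_smult M_zero M_add_closed M_scale_closed
        M_zero_closed weighted_sum_add weighted_sum_scale weighted_sum_zero)
  then show "N \<subseteq> {p \<in> carrier M. \<forall>c. weighted_sum g p c = 0}"
    using R_carrier R_zero by (intro span_is_subset) auto
next
  show "{p \<in> carrier M. \<forall>c. weighted_sum g p c = 0} \<subseteq> N"
  proof
    fix p assume p: "p \<in> {p \<in> carrier M. \<forall>c. weighted_sum g p c = 0}"
    let ?K = "Poly_Mapping.keys p" and ?a = "Poly_Mapping.lookup p"
    have "(\<Sum>s\<in>?K. Poly_Mapping.map ((*) (?a s))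
        (Poly_Mapping.single s 1 - (\<Sum>c\<in>C. Poly_Mapping.single (nf c) (g s c)))) \<in> N"
      using p by (intro N_sum N_scale reduce) (auto simp: M_carrier)
    also have "(\<Sum>s\<in>?K. Poly_Mapping.map ((*) (?a s))
        (Poly_Mapping.single s 1 - (\<Sum>c\<in>C. Poly_Mapping.single (nf c) (g s c)))) = p"
    proof (rule poly_mapping_eqI)
      fix t
      have "(\<Sum>s\<in>?K. ?a s * (\<Sum>c\<in>C. g s c when nf c = t)) = (\<Sum>c\<in>C. weighted_sum g p c when nf c = t)"
        by (simp add: sum_distrib_left sum.swap[of _ C] weighted_sum_def when_def)
           (rule sum.cong, auto simp: sum_distrib_left)
      also have "\<dots> = 0" using p by simp
      finally have "(\<Sum>s\<in>?K. ?a s * (\<Sum>c\<in>C. g s c when nf c = t)) = 0" .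
      moreover have "(\<Sum>s\<in>?K. ?a s * (1 when s = t)) = ?a t"
        by (simp add: when_def if_distrib[of "\<lambda>z. _ * z"] in_keys_iff cong: if_cong)
      ultimately show "Poly_Mapping.lookup (\<Sum>s\<in>?K. Poly_Mapping.map ((*) (?a s))
        (Poly_Mapping.single s 1 - (\<Sum>c\<in>C. Poly_Mapping.single (nf c) (g s c)))) t = ?a t"
        by (simp add: lookup_sum lookup_minus lookup_single right_diff_distrib sum_subtractf)
    qed
    finally show "p \<in> N" .
  qed
qed

abbreviation Q :: "('k, ('s \<Rightarrow>\<^sub>0 'k) set) module" where
  "Q \<equiv> quotient_module M N"

abbreviation cls :: "('s \<Rightarrow>\<^sub>0 'k) \<Rightarrow> ('s \<Rightarrow>\<^sub>0 'k) set" where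
  "cls p \<equiv> N +>\<^bsub>M\<^esub> p"

definition coord :: "('s \<Rightarrow>\<^sub>0 'k) set \<Rightarrow> 'c \<Rightarrow> 'k" where
  "coord X = weighted_sum g (SOME p. p \<in> X)"

text \<open>Classes are the fibres of the coordinate map; this reduces all questions about representatives to
  coordinates.\<close>

lemma cls_eq: "p \<in> carrier M \<Longrightarrow> cls p = {q \<in> carrier M. weighted_sum g q = weighted_sum g p}"
proof (intro equalityI subsetI)
  fix q assume p: "p \<in> carrier M" and "q \<in> {q \<in> carrier M. weighted_sum g q = weighted_sum g p}"
  then have "q - p \<in> N" by (simp add: span_eq_kernel M_diff_closed weighted_sum_diff)
  then show "q \<in> cls p" by (force simp: a_r_coset_def' M_add)
qed (auto simp: a_r_coset_def' M_add span_eq_kernel M_add_closed weighted_sum_add fun_eq_iff)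

lemma coord_cls: 
  assumes "p \<in> carrier M"
  shows "coord (cls p) = weighted_sum g p"
proof -
  have "p \<in> cls p" using assms by (simp add: cls_eq)
  then have "(SOME q. q \<in> cls p) \<in> cls p" by (metis some_in_eq empty_iff)
  then show ?thesis using assms by (simp add: coord_def cls_eq)
qed

lemma Q_carrier: "carrier Q = cls ` carrier M"
  by (auto simp: quotient_module_def FactRing_def A_RCOSETS_def')

lemma Q_add: 
  assumes "p \<in> carrier M" "q \<in> carrier M"
  shows "cls p \<oplus>\<^bsub>Q\<^esub> cls q = cls (p + q)"
proof -
  have "cls p \<oplus>\<^bsub>Q\<^esub> cls q = {x + y |x y. x \<in> cls p \<and> y \<in> cls q}"
    by (auto simp: quotient_module_def FactRing_def set_add_def' M_add)
  also have "\<dots> = cls (p + q)"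
  proof (intro equalityI subsetI)
    fix z assume "z \<in> cls (p + q)"
    then have z: "z \<in> carrier M" "weighted_sum g z = weighted_sum g (p + q)" using assms by (auto simp: cls_eq M_add_closed)
    have "z = p + (z - p)" "p \<in> cls p" "z - p \<in> cls q"
      using assms z by (auto simp: cls_eq M_diff_closed weighted_sum_diff weighted_sum_add fun_eq_iff)
    then show "z \<in> {x + y |x y. x \<in> cls p \<and> y \<in> cls q}" by blast
  qed (use assms in \<open>auto simp: cls_eq M_add_closed weighted_sum_add fun_eq_iff\<close>)
  finally show ?thesis .
qed

lemma Q_smult:
  assumes "p \<in> carrier M"
  shows "a \<odot>\<^bsub>Q\<^esub> cls p = cls (Poly_Mapping.map ((*) a) p)"
proof -
  have *: "\<forall>q\<in>cls p. cls (Poly_Mapping.map ((*) a) q) = cls (Poly_Mapping.map ((*) a) p)"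
    using assms by (simp add: cls_eq M_scale_closed weighted_sum_scale fun_eq_iff)
  have "p \<in> cls p" using assms by (simp add: cls_eq)
  then have "(\<Union>q\<in>cls p. cls (Poly_Mapping.map ((*) a) q)) = cls (Poly_Mapping.map ((*) a) p)"
    using * by (rule UN_constant_eq)
  then show ?thesis by (simp add: quotient_module_def M_smult)
qed

lemma Q_zero: "\<zero>\<^bsub>Q\<^esub> = cls 0"
proof -
  have "cls 0 = N" by (simp add: a_r_coset_def' M_add)
  then show ?thesis by (simp add: quotient_module_def FactRing_def)
qed

lemma weighted_sum_supp: "p \<in> carrier M \<Longrightarrow> weighted_sum g p \<in> supported_on C"
  using g_supp by (auto simp: M_carrier supported_on_def weighted_sum_def intro!: sum.neutral)

lemma weighted_sum_nf:
  assumes "c \<in> C"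
  shows "weighted_sum g (Poly_Mapping.single (nf c) 1) = (\<lambda>d. if d = c then 1 else 0)"
proof
  fix d
  show "weighted_sum g (Poly_Mapping.single (nf c) 1) d = (if d = c then 1 else 0)"
    using assms g_nf[OF assms, of d] g_supp[OF nf_S[OF assms], of d]
    by (cases "d \<in> C") (auto simp: weighted_sum_single)
qed

lemma coord_space_Q: "coord_space Q coord C (\<lambda>c. cls (Poly_Mapping.single (nf c) 1))"
proof
  show "\<zero>\<^bsub>Q\<^esub> \<in> carrier Q" "coord \<zero>\<^bsub>Q\<^esub> = (\<lambda>_. 0)"
    by (auto simp: Q_zero Q_carrier M_zero_closed coord_cls weighted_sum_zero fun_eq_iff)
  show "x \<oplus>\<^bsub>Q\<^esub> y \<in> carrier Q \<and> coord (x \<oplus>\<^bsub>Q\<^esub> y) = (\<lambda>c. coord x c + coord y c)"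
    if "x \<in> carrier Q" "y \<in> carrier Q" for x y
    using that by (auto simp: Q_carrier Q_add coord_cls M_add_closed weighted_sum_add)
  show "a \<odot>\<^bsub>Q\<^esub> x \<in> carrier Q \<and> coord (a \<odot>\<^bsub>Q\<^esub> x) = (\<lambda>c. a * coord x c)"
    if "x \<in> carrier Q" for a x
    using that by (auto simp: Q_carrier Q_smult coord_cls M_scale_closed weighted_sum_scale)
  show "inj_on coord (carrier Q)"
  proof (rule inj_onI)
    fix x y assume xy: "x \<in> carrier Q" "y \<in> carrier Q" "coord x = coord y"
    then obtain p q where pq: "p \<in> carrier M" "x = cls p" "q \<in> carrier M" "y = cls q"
      by (auto simp: Q_carrier)
    then have "weighted_sum g p = weighted_sum g q" using xy by (simp add: coord_cls)
    then show "x = y" using pq by (simp add: cls_eq)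
  qed
  show "coord ` carrier Q = supported_on C"
  proof (intro equalityI subsetI)
    fix a :: "'c \<Rightarrow> 'k" assume a: "a \<in> supported_on C"
    define p where "p = (\<Sum>c\<in>C. Poly_Mapping.single (nf c) (a c))"
    have "p \<in> carrier M"
    proof -
      have "(\<Sum>c\<in>D. Poly_Mapping.single (nf c) (a c)) \<in> carrier M"
        if "D \<subseteq> C" for D
        using that
        by (induction D rule: infinite_finite_induct)
           (auto simp: M_zero_closed M_add_closed M_scale_closed M_single_closed nf_S)
      then show ?thesis by (simp add: p_def)
    qed
    moreover have "weighted_sum g p = a"
    proof
      fix d
      have "weighted_sum g (Poly_Mapping.single (nf c) (a c)) d = (if d = c then a c else 0)" if "c \<in> C" for c
        using fun_cong[OF weighted_sum_nf[OF that], of d] by (simp add: weighted_sum_single)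
      then have "weighted_sum g p d = (\<Sum>c\<in>C. if d = c then a c else 0)"
        unfolding p_def weighted_sum_sum by (rule sum.cong[OF refl])
      then show "weighted_sum g p d = a d" using a finC by (simp add: supported_on_def)
    qed
    ultimately show "a \<in> coord ` carrier Q" by (auto simp: Q_carrier coord_cls image_iff intro!: bexI[of _ p])
  qed (auto simp: Q_carrier coord_cls weighted_sum_supp)
  show "finite C" by (rule finC)
  fix c assume c: "c \<in> C"
  show "cls (Poly_Mapping.single (nf c) 1) \<in> carrier Q"
    using M_single_closed[OF nf_S[OF c]] by (auto simp: Q_carrier)
  show "coord (cls (Poly_Mapping.single (nf c) 1)) = (\<lambda>d. if d = c then 1 else 0)"
    using c by (simp add: coord_cls M_single_closed nf_S weighted_sum_nf)
qed

lemma cls_eqI: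
  "p \<in> carrier M \<Longrightarrow> q \<in> carrier M \<Longrightarrow> (\<And>c. weighted_sum g p c = weighted_sum g q c) \<Longrightarrow> cls p = cls q"
  by (simp add: cls_eq fun_eq_iff)

end

section \<open>Coordinates on the truncated polynomial algebra\<close>

lemma finsupp_module_poly_algebra: "finsupp_module (poly_algebra l :: ('k::field, 'k mpoly) module) (exponents l)"
  by unfold_locales (simp_all add: poly_algebra_def)

text \<open>Coordinates of a monomial in the truncated algebra: monomials that survive the truncation are
  normal forms, the others become zero.\<close>

definition mono_coord :: "(nat \<Rightarrow>\<^sub>0 nat) set \<Rightarrow> (nat \<Rightarrow>\<^sub>0 nat) \<Rightarrow> (nat \<Rightarrow>\<^sub>0 nat) \<Rightarrow> 'k::field" where
  "mono_coord W \<omega> \<gamma> = (if \<gamma> = \<omega> \<and> \<omega> \<in> W then 1 else 0)"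

lemma weighted_sum_mono_coord:
  "weighted_sum (mono_coord W) p \<gamma> = (if \<gamma> \<in> W then Poly_Mapping.lookup p \<gamma> else 0)"
proof -
  have "weighted_sum (mono_coord W) p \<gamma> = (\<Sum>s\<in>Poly_Mapping.keys p. if s = \<gamma> then (if \<gamma> \<in> W then Poly_Mapping.lookup p s else 0) else 0)"
    unfolding weighted_sum_def mono_coord_def by (intro sum.cong) auto
  then show ?thesis by (simp add: in_keys_iff)
qed

lemma finsupp_quotient_truncated:
  assumes "\<mu> \<in> exponents l"
  shows "finsupp_quotient (poly_algebra l :: ('k::field, 'k mpoly) module) (exponents l)
    (mono_coord (exponents_le l \<mu>)) (monomial ` {\<omega> \<in> exponents l. \<not> exp_le \<omega> \<mu>})
    (exponents_le l \<mu>) (\<lambda>\<omega>. \<omega>)"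
proof -
  let ?M = "poly_algebra l :: ('k, 'k mpoly) module" and ?W = "exponents_le l \<mu>"
  let ?R = "monomial ` {\<omega> \<in> exponents l. \<not> exp_le \<omega> \<mu>} :: 'k mpoly set"
  interpret finsupp_module ?M "exponents l" by (rule finsupp_module_poly_algebra)
  interpret V: vectorspace class_ring ?M by (rule vs_M)
  have R: "?R \<subseteq> carrier ?M" by (auto simp: monomial_def M_single_closed)
  show ?thesis
  proof
    show "finite ?W" by (rule finite_exponents_le[OF assms])
    show "?R \<subseteq> carrier ?M" by (rule R)
    show "weighted_sum (mono_coord ?W) r c = 0" if "r \<in> ?R" for r c
      using that by (auto simp: monomial_def weighted_sum_single mono_coord_def exponents_le_def)
    fix s assume s: "s \<in> exponents l"
    show "Poly_Mapping.single s 1 - (\<Sum>c\<in>?W. Poly_Mapping.single c (mono_coord ?W s c)) \<in> V.span ?R"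
    proof (cases "s \<in> ?W")
      case True
      have "(\<Sum>c\<in>?W. Poly_Mapping.single c (mono_coord ?W s c :: 'k)) =
        (\<Sum>c\<in>?W. if c = s then Poly_Mapping.single s 1 else 0)"
        using True by (intro sum.cong) (auto simp: mono_coord_def)
      then have "Poly_Mapping.single s 1 - (\<Sum>c\<in>?W. Poly_Mapping.single c (mono_coord ?W s c)) = (0 :: 'k mpoly)"
        using True finite_exponents_le[OF assms] by simp
      then show ?thesis using V.span_zero by (simp add: M_zero)
    next
      case False
      then have "Poly_Mapping.single s 1 \<in> ?R"
        using s by (auto simp: monomial_def exponents_le_def)
      moreover have "(\<Sum>c\<in>?W. Poly_Mapping.single c (mono_coord ?W s c :: 'k)) = 0"
        using False by (intro sum.neutral) (auto simp: mono_coord_def)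
      ultimately show ?thesis using V.in_own_span[OF R] by auto
    qed
  qed (auto simp: mono_coord_def exponents_le_def)
qed

definition trunc_coord :: "nat \<Rightarrow> (nat \<Rightarrow>\<^sub>0 nat) \<Rightarrow> 'k::field mpoly set \<Rightarrow> (nat \<Rightarrow>\<^sub>0 nat) \<Rightarrow> 'k" where
  "trunc_coord l \<mu> = finsupp_quotient.coord (mono_coord (exponents_le l \<mu>))"

lemma exponents_le_addD:
  assumes "\<alpha> + \<beta> \<in> exponents_le l \<mu>"
  shows "\<alpha> \<in> exponents_le l \<mu>" "\<beta> \<in> exponents_le l \<mu>"
proof -
  have le: "exp_le \<alpha> (\<alpha> + \<beta>)" "exp_le \<beta> (\<alpha> + \<beta>)"
    by (simp_all add: exp_le_def lookup_add)
  have keys: "Poly_Mapping.keys \<alpha> \<subseteq> Poly_Mapping.keys (\<alpha> + \<beta>)"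
    "Poly_Mapping.keys \<beta> \<subseteq> Poly_Mapping.keys (\<alpha> + \<beta>)"
    by (auto simp: in_keys_iff lookup_add)
  have trans: "exp_le \<omega> \<mu>" if "exp_le \<omega> (\<alpha> + \<beta>)" for \<omega>
    using that assms unfolding exponents_le_def exp_le_def by (blast intro: order_trans)
  show "\<alpha> \<in> exponents_le l \<mu>" "\<beta> \<in> exponents_le l \<mu>"
    using assms le keys trans by (auto simp: exponents_le_def exponents_def)
qed

text \<open>A coefficient below \<open>\<mu>\<close> of a product involves only coefficients below \<open>\<mu>\<close> of the factors, so the
  product is well defined after truncation.\<close>

lemma lookup_mult_truncated:
  fixes p q :: "'k::field mpoly"
  assumes W: "finite (exponents_le l \<mu>)" and \<gamma>: "\<gamma> \<in> exponents_le l \<mu>"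
  shows "Poly_Mapping.lookup (p * q) \<gamma> = (\<Sum>\<alpha>\<in>exponents_le l \<mu>. \<Sum>\<beta>\<in>exponents_le l \<mu>.
    Poly_Mapping.lookup p \<alpha> * Poly_Mapping.lookup q \<beta> * (if \<alpha> + \<beta> = \<gamma> then 1 else 0))"
proof -
  let ?W = "exponents_le l \<mu>"
  let ?h = "\<lambda>\<alpha> \<beta>. Poly_Mapping.lookup p \<alpha> * Poly_Mapping.lookup q \<beta> * (if \<alpha> + \<beta> = \<gamma> then 1 else 0 :: 'k)"
  let ?A = "Poly_Mapping.keys p \<union> ?W" and ?B = "Poly_Mapping.keys q \<union> ?W"
  have expand: "r = (\<Sum>s\<in>Poly_Mapping.keys r. Poly_Mapping.single s (Poly_Mapping.lookup r s))" for r :: "'k mpoly"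
    by (rule poly_mapping_eqI) (simp add: lookup_sum lookup_single when_def in_keys_iff)
  have "p * q = (\<Sum>s\<in>Poly_Mapping.keys p. \<Sum>t\<in>Poly_Mapping.keys q.
      Poly_Mapping.single (s + t) (Poly_Mapping.lookup p s * Poly_Mapping.lookup q t))"
    by (subst (1) expand[of p], subst (1) expand[of q]) (simp add: sum_product mult_single)
  then have "Poly_Mapping.lookup (p * q) \<gamma> = (\<Sum>s\<in>Poly_Mapping.keys p. \<Sum>t\<in>Poly_Mapping.keys q. ?h s t)"
    by (simp add: lookup_sum lookup_single when_def) (intro sum.cong refl, auto)
  also have "\<dots> = (\<Sum>s\<in>Poly_Mapping.keys p. \<Sum>t\<in>?B. ?h s t)"
    using W by (intro sum.cong refl sum.mono_neutral_left) (auto simp: in_keys_iff)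
  also have "\<dots> = (\<Sum>s\<in>?A. \<Sum>t\<in>?B. ?h s t)"
    using W by (intro sum.mono_neutral_left) (auto simp: in_keys_iff)
  also have "\<dots> = (\<Sum>s\<in>?W. \<Sum>t\<in>?B. ?h s t)"
    using W \<gamma> by (intro sum.mono_neutral_right) (auto intro!: sum.neutral dest: exponents_le_addD)
  also have "\<dots> = (\<Sum>s\<in>?W. \<Sum>t\<in>?W. ?h s t)"
    using W \<gamma> by (intro sum.cong refl sum.mono_neutral_right) (auto dest: exponents_le_addD)
  finally show ?thesis .
qed

lemma truncated_algebra_coords:
  fixes \<mu> :: "nat \<Rightarrow>\<^sub>0 nat"
  assumes "\<mu> \<in> exponents l"
  defines "W \<equiv> exponents_le l \<mu>"
    and "A \<equiv> truncated_algebra l \<mu> :: ('k::field, 'k mpoly set) module"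
    and "\<psi> \<equiv> trunc_coord l \<mu> :: 'k mpoly set \<Rightarrow> (nat \<Rightarrow>\<^sub>0 nat) \<Rightarrow> 'k"
  shows "coord_space A \<psi> W (tau l \<mu>)"
    and "coord_space.bilinear_op A \<psi> W (tau l \<mu>) (mult A)"
    and "\<alpha> \<in> W \<Longrightarrow> \<beta> \<in> W \<Longrightarrow>
      \<psi> (tau l \<mu> \<alpha> \<otimes>\<^bsub>A\<^esub> tau l \<mu> \<beta>) \<gamma> = (if \<gamma> = \<alpha> + \<beta> \<and> \<gamma> \<in> W then 1 else 0)"
proof -
  let ?M = "poly_algebra l :: ('k, 'k mpoly) module"
  interpret finsupp_quotient ?M "exponents l" "mono_coord W" "monomial ` {\<omega> \<in> exponents l. \<not> exp_le \<omega> \<mu>}" W "\<lambda>\<omega>. \<omega>"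
    unfolding W_def by (rule finsupp_quotient_truncated[OF assms(1)])
  have A: "A = Q" by (simp add: A_def truncated_algebra_def truncation_ideal_def)
  have \<psi>: "\<psi> = coord" by (simp add: \<psi>_def trunc_coord_def W_def)
  have tau: "tau l \<mu> = (\<lambda>\<omega>. cls (Poly_Mapping.single \<omega> 1))"
    by (simp add: fun_eq_iff tau_def truncation_ideal_def monomial_def)
  have cs: "coord_space A \<psi> W (tau l \<mu>)"
    unfolding A \<psi> tau by (rule coord_space_Q)
  then show "coord_space A \<psi> W (tau l \<mu>)" .
  interpret coord_space A \<psi> W "tau l \<mu>" by (rule cs)
  have mult_M: "mult ?M = (*)" by (simp add: poly_algebra_def)
  have closed: "p * q \<in> carrier ?M" if "p \<in> carrier ?M" "q \<in> carrier ?M" for p q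
  proof -
    have "a + b \<in> exponents l" if "a \<in> Poly_Mapping.keys p" "b \<in> Poly_Mapping.keys q" for a b
      using that \<open>p \<in> carrier ?M\<close> \<open>q \<in> carrier ?M\<close> by (intro exponents_add) (auto simp: M_carrier)
    then show ?thesis using keys_mult[of p q] by (auto simp: M_carrier)
  qed
  have prod: "weighted_sum (mono_coord W) (p * q) \<gamma> = (if \<gamma> \<in> W then \<Sum>\<alpha>\<in>W. \<Sum>\<beta>\<in>W.
      weighted_sum (mono_coord W) p \<alpha> * weighted_sum (mono_coord W) q \<beta> * (if \<alpha> + \<beta> = \<gamma> then 1 else 0) else 0)" for p q :: "'k mpoly" and \<gamma>
    unfolding weighted_sum_mono_coord W_def using lookup_mult_truncated[OF finC[unfolded W_def], of \<gamma> p q]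
    by simp
  have mult: "cls p \<otimes>\<^bsub>A\<^esub> cls q = cls (p * q)" if "p \<in> carrier ?M" "q \<in> carrier ?M" for p q
  proof -
    have "cls (x * y) = cls (p * q)" if "x \<in> cls p" "y \<in> cls q" for x y
      using that \<open>p \<in> carrier ?M\<close> \<open>q \<in> carrier ?M\<close>
      by (intro cls_eqI closed) (auto simp: cls_eq prod)
    moreover have "p \<in> cls p" "q \<in> cls q" using that by (auto simp: cls_eq)
    ultimately have "(\<Union>x\<in>cls p. \<Union>y\<in>cls q. cls (x * y)) = cls (p * q)"
      by (intro equalityI subsetI) blast+
    then show ?thesis
      by (simp add: A quotient_module_def FactRing_def rcoset_mult_def mult_M)
  qed
  have formula: "x \<otimes>\<^bsub>A\<^esub> y \<in> carrier A" "\<psi> (x \<otimes>\<^bsub>A\<^esub> y) \<gamma> =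
      (if \<gamma> \<in> W then \<Sum>\<alpha>\<in>W. \<Sum>\<beta>\<in>W. \<psi> x \<alpha> * \<psi> y \<beta> * (if \<alpha> + \<beta> = \<gamma> then 1 else 0) else 0)"
    if xy: "x \<in> carrier A" "y \<in> carrier A" for x y \<gamma>
  proof -
    obtain p q where pq: "p \<in> carrier ?M" "x = cls p" "q \<in> carrier ?M" "y = cls q"
      using xy by (auto simp: A Q_carrier)
    have "x \<otimes>\<^bsub>A\<^esub> y = cls (p * q)" using mult pq by simp
    then show "x \<otimes>\<^bsub>A\<^esub> y \<in> carrier A" "\<psi> (x \<otimes>\<^bsub>A\<^esub> y) \<gamma> =
      (if \<gamma> \<in> W then \<Sum>\<alpha>\<in>W. \<Sum>\<beta>\<in>W. \<psi> x \<alpha> * \<psi> y \<beta> * (if \<alpha> + \<beta> = \<gamma> then 1 else 0) else 0)"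
      using pq closed by (auto simp: A \<psi> Q_carrier coord_cls prod)
  qed
  show basis: "\<psi> (tau l \<mu> \<alpha> \<otimes>\<^bsub>A\<^esub> tau l \<mu> \<beta>) \<gamma> = (if \<gamma> = \<alpha> + \<beta> \<and> \<gamma> \<in> W then 1 else 0)"
    if "\<alpha> \<in> W" "\<beta> \<in> W" for \<alpha> \<beta> \<gamma>
  proof -
    have "(\<Sum>\<alpha>'\<in>W. \<Sum>\<beta>'\<in>W. \<psi> (tau l \<mu> \<alpha>) \<alpha>' * \<psi> (tau l \<mu> \<beta>) \<beta>' * (if \<alpha>' + \<beta>' = \<gamma> then 1 else 0))
      = (if \<alpha> + \<beta> = \<gamma> then 1 else 0)"
      using sum_coords_basis[OF that(1), of "\<lambda>a. \<Sum>\<beta>'\<in>W. \<psi> (tau l \<mu> \<beta>) \<beta>' * (if a + \<beta>' = \<gamma> then 1 else 0)"]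
        sum_coords_basis[OF that(2), of "\<lambda>b. if \<alpha> + b = \<gamma> then 1 else 0"]
      by (simp add: sum_distrib_left mult.assoc)
    then show ?thesis using formula(2)[OF b(1) b(1), OF that, of \<gamma>] by auto
  qed
  show "bilinear_op (mult A)"
    unfolding bilinear_op_def
  proof (intro ballI conjI allI formula(1))
    fix x y \<gamma> assume xy: "x \<in> carrier A" "y \<in> carrier A"
    show "\<psi> (x \<otimes>\<^bsub>A\<^esub> y) \<gamma> = (\<Sum>\<alpha>\<in>W. \<Sum>\<beta>\<in>W. \<psi> x \<alpha> * \<psi> y \<beta> * \<psi> (tau l \<mu> \<alpha> \<otimes>\<^bsub>A\<^esub> tau l \<mu> \<beta>) \<gamma>)"
      unfolding formula(2)[OF xy]
      by (cases "\<gamma> \<in> W") (auto simp: basis intro!: sum.cong)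
  qed
qed

section \<open>Coordinates on the tensor product\<close>

definition pair_coord :: "('v \<Rightarrow> 'i \<Rightarrow> 'k::field) \<Rightarrow> ('w \<Rightarrow> 'j \<Rightarrow> 'k) \<Rightarrow> 'v \<times> 'w \<Rightarrow> 'j \<times> 'i \<Rightarrow> 'k" where
  "pair_coord \<phi> \<psi> = (\<lambda>(v, w) (\<gamma>, i). \<phi> v i * \<psi> w \<gamma>)"

lemma finsupp_module_free_module: "finsupp_module (free_module S :: ('k::field, 's \<Rightarrow>\<^sub>0 'k) module) S"
  by unfold_locales (simp_all add: free_module_def)

text \<open>Expanding first the left and then the right argument in a basis reduces a generator \<open>(v, w)\<close> to pairs
  of basis vectors. The pairs of indices are ordered with the index of the right factor first, to match
  the block matrices.\<close>

lemma finsupp_quotient_tensor: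
  fixes V :: "('k::field, 'v, 'm) module_scheme" and U :: "('k, 'w, 'n) module_scheme"
  assumes "coord_space V \<phi> B b" "coord_space U \<psi> W t"
  shows "finsupp_quotient (free_module (carrier V \<times> carrier U)) (carrier V \<times> carrier U)
    (pair_coord \<phi> \<psi>) (tensor_relations V U) (W \<times> B) (\<lambda>(\<gamma>, i). (b i, t \<gamma>))"
proof -
  interpret V: coord_space V \<phi> B b by fact
  interpret U: coord_space U \<psi> W t by fact
  let ?S = "carrier V \<times> carrier U"
  let ?M = "free_module ?S :: ('k, 'v \<times> 'w \<Rightarrow>\<^sub>0 'k) module"
  let ?R = "tensor_relations V U" and ?g = "pair_coord \<phi> \<psi>"
  let ?s = "\<lambda>v w. Poly_Mapping.single (v, w)"
  interpret finsupp_module ?M ?S by (rule finsupp_module_free_module)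
  interpret M: vectorspace class_ring ?M by (rule vs_M)
  have sgl: "?s v w a \<in> carrier ?M" if "v \<in> carrier V" "w \<in> carrier U" for v w a
    using that by (intro M_single_closed) auto
  have R: "?R \<subseteq> carrier ?M"
    unfolding tensor_relations_def
    by (auto intro!: M_diff_closed sgl simp: V.add U.add V.smult U.smult)
  let ?N = "M.span ?R"
  have sub: "LinearCombinations.submodule class_ring ?N ?M" by (rule span_submodule[OF R])
  have N_add: "p + q \<in> ?N" if "p \<in> ?N" "q \<in> ?N" for p q
    using sub that by (auto simp: LinearCombinations.submodule_def M_add)
  have N_scale: "Poly_Mapping.map ((*) a) p \<in> ?N" if "p \<in> ?N" for a p
    using sub that by (auto simp: LinearCombinations.submodule_def M_smult)
  have N_zero: "0 \<in> ?N" using sub by (auto simp: LinearCombinations.submodule_def M_zero)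
  have N_sum: "(\<Sum>i\<in>I. p i) \<in> ?N" if "\<And>i. i \<in> I \<Longrightarrow> p i \<in> ?N" for I :: "'i set" and p
    using that by (induction I rule: infinite_finite_induct) (auto simp: N_zero N_add)
  have RN: "r \<in> ?N" if "r \<in> ?R" for r using M.in_own_span[OF R] that by auto
  have rel_add1: "?s (v \<oplus>\<^bsub>V\<^esub> v') w 1 - ?s v w 1 - ?s v' w 1 \<in> ?N"
    if "v \<in> carrier V" "v' \<in> carrier V" "w \<in> carrier U" for v v' w
    using that by (intro RN) (auto simp: tensor_relations_def)
  have rel_add2: "?s v (w \<oplus>\<^bsub>U\<^esub> w') 1 - ?s v w 1 - ?s v w' 1 \<in> ?N"
    if "v \<in> carrier V" "w' \<in> carrier U" "w \<in> carrier U" for v w' w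
    using that by (intro RN) (auto simp: tensor_relations_def)
  have rel_smult1: "?s (a \<odot>\<^bsub>V\<^esub> v) w 1 - ?s v w a \<in> ?N"
    if "v \<in> carrier V" "w \<in> carrier U" for a v w
    using that by (intro RN) (auto simp: tensor_relations_def)
  have rel_smult2: "?s v (a \<odot>\<^bsub>U\<^esub> w) 1 - ?s v w a \<in> ?N"
    if "v \<in> carrier V" "w \<in> carrier U" for a v w
    using that by (intro RN) (auto simp: tensor_relations_def)
  have zero_smult: "0 \<odot>\<^bsub>V\<^esub> \<zero>\<^bsub>V\<^esub> = \<zero>\<^bsub>V\<^esub>" "0 \<odot>\<^bsub>U\<^esub> \<zero>\<^bsub>U\<^esub> = \<zero>\<^bsub>U\<^esub>"
    using V.smult[OF V.zero(1), of 0] U.smult[OF U.zero(1), of 0] V.zero U.zero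
    by (auto intro!: V.eqI U.eqI)
  have red1: "?s v w 1 - (\<Sum>i\<in>B. ?s (b i) w (\<phi> v i)) \<in> ?N"
    if v: "v \<in> carrier V" and w: "w \<in> carrier U" for v w
    using v
  proof (rule V.coord_induct)
    show "?s \<zero>\<^bsub>V\<^esub> w 1 - (\<Sum>i\<in>B. ?s (b i) w (\<phi> \<zero>\<^bsub>V\<^esub> i)) \<in> ?N"
      using rel_smult1[OF V.zero(1) w, of 0] by (simp add: V.zero zero_smult)
  next
    fix x y assume xy: "x \<in> carrier V" "y \<in> carrier V"
      "?s x w 1 - (\<Sum>i\<in>B. ?s (b i) w (\<phi> x i)) \<in> ?N" "?s y w 1 - (\<Sum>i\<in>B. ?s (b i) w (\<phi> y i)) \<in> ?N"
    have "(?s (x \<oplus>\<^bsub>V\<^esub> y) w 1 - ?s x w 1 - ?s y w 1) + (?s x w 1 - (\<Sum>i\<in>B. ?s (b i) w (\<phi> x i)))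
      + (?s y w 1 - (\<Sum>i\<in>B. ?s (b i) w (\<phi> y i))) \<in> ?N"
      by (intro N_add rel_add1 xy w)
    then show "?s (x \<oplus>\<^bsub>V\<^esub> y) w 1 - (\<Sum>i\<in>B. ?s (b i) w (\<phi> (x \<oplus>\<^bsub>V\<^esub> y) i)) \<in> ?N"
      using V.add[OF xy(1,2)] by (simp add: single_add sum.distrib algebra_simps)
  next
    fix a i assume i: "i \<in> B"
    have "(\<Sum>j\<in>B. ?s (b j) w (\<phi> (a \<odot>\<^bsub>V\<^esub> b i) j)) = (\<Sum>j\<in>B. if j = i then ?s (b i) w a else 0)"
      using V.smult[OF V.b(1)[OF i], of a] V.b(2)[OF i] by (intro sum.cong) auto
    then show "?s (a \<odot>\<^bsub>V\<^esub> b i) w 1 - (\<Sum>j\<in>B. ?s (b j) w (\<phi> (a \<odot>\<^bsub>V\<^esub> b i) j)) \<in> ?N"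
      using rel_smult1[OF V.b(1)[OF i] w, of a] i V.finC by simp
  qed
  have red2: "?s v w 1 - (\<Sum>\<gamma>\<in>W. ?s v (t \<gamma>) (\<psi> w \<gamma>)) \<in> ?N"
    if w: "w \<in> carrier U" and v: "v \<in> carrier V" for v w
    using w
  proof (rule U.coord_induct)
    show "?s v \<zero>\<^bsub>U\<^esub> 1 - (\<Sum>i\<in>W. ?s v (t i) (\<psi> \<zero>\<^bsub>U\<^esub> i)) \<in> ?N"
      using rel_smult2[OF v U.zero(1), of 0] by (simp add: U.zero zero_smult)
  next
    fix x y assume xy: "x \<in> carrier U" "y \<in> carrier U"
      "?s v x 1 - (\<Sum>i\<in>W. ?s v (t i) (\<psi> x i)) \<in> ?N" "?s v y 1 - (\<Sum>i\<in>W. ?s v (t i) (\<psi> y i)) \<in> ?N"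
    have "(?s v (x \<oplus>\<^bsub>U\<^esub> y) 1 - ?s v x 1 - ?s v y 1) + (?s v x 1 - (\<Sum>i\<in>W. ?s v (t i) (\<psi> x i)))
      + (?s v y 1 - (\<Sum>i\<in>W. ?s v (t i) (\<psi> y i))) \<in> ?N"
      by (intro N_add rel_add2 xy v)
    then show "?s v (x \<oplus>\<^bsub>U\<^esub> y) 1 - (\<Sum>i\<in>W. ?s v (t i) (\<psi> (x \<oplus>\<^bsub>U\<^esub> y) i)) \<in> ?N"
      using U.add[OF xy(1,2)] by (simp add: single_add sum.distrib algebra_simps)
  next
    fix a i assume i: "i \<in> W"
    have "(\<Sum>j\<in>W. ?s v (t j) (\<psi> (a \<odot>\<^bsub>U\<^esub> t i) j)) = (\<Sum>j\<in>W. if j = i then ?s v (t i) a else 0)"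
      using U.smult[OF U.b(1)[OF i], of a] U.b(2)[OF i] by (intro sum.cong) auto
    then show "?s v (a \<odot>\<^bsub>U\<^esub> t i) 1 - (\<Sum>j\<in>W. ?s v (t j) (\<psi> (a \<odot>\<^bsub>U\<^esub> t i) j)) \<in> ?N"
      using rel_smult2[OF v U.b(1)[OF i], of a] i U.finC by simp
  qed
  show ?thesis
  proof
    show "finite (W \<times> B)" using V.finC U.finC by simp
    show "?g s c = 0" if "s \<in> ?S" "c \<notin> W \<times> B" for s c
      using that V.coords_outside U.coords_outside by (cases c) (auto simp: pair_coord_def)
    show "(case c of (\<gamma>, i) \<Rightarrow> (b i, t \<gamma>)) \<in> ?S" if "c \<in> W \<times> B" for c
      using that V.b U.b by auto
    show "?g (case c of (\<gamma>, i) \<Rightarrow> (b i, t \<gamma>)) d = (if d = c then 1 else 0)"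
      if "c \<in> W \<times> B" "d \<in> W \<times> B" for c d
      using that V.b U.b by (cases c, cases d) (auto simp: pair_coord_def)
    show "?R \<subseteq> carrier ?M" by (rule R)
    show "weighted_sum ?g r c = 0" if "r \<in> ?R" for r c
      using that by (cases c) (auto simp: tensor_relations_def weighted_sum_diff weighted_sum_single pair_coord_def
          V.add U.add V.smult U.smult ring_distribs mult_ac)
    fix s assume "s \<in> ?S"
    then obtain v w where s: "s = (v, w)" "v \<in> carrier V" "w \<in> carrier U" by auto
    \<comment> \<open>expand \<open>v\<close>, then \<open>w\<close> in each of the resulting terms\<close>
    have "(?s v w 1 - (\<Sum>i\<in>B. ?s (b i) w (\<phi> v i))) + (\<Sum>i\<in>B. Poly_Mapping.map ((*) (\<phi> v i))
        (?s (b i) w 1 - (\<Sum>\<gamma>\<in>W. ?s (b i) (t \<gamma>) (\<psi> w \<gamma>)))) \<in> ?N"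
      by (intro N_add N_sum N_scale red1 red2 s V.b)
    also have "(?s v w 1 - (\<Sum>i\<in>B. ?s (b i) w (\<phi> v i))) + (\<Sum>i\<in>B. Poly_Mapping.map ((*) (\<phi> v i))
        (?s (b i) w 1 - (\<Sum>\<gamma>\<in>W. ?s (b i) (t \<gamma>) (\<psi> w \<gamma>)))) =
      ?s v w 1 - (\<Sum>i\<in>B. \<Sum>\<gamma>\<in>W. ?s (b i) (t \<gamma>) (\<phi> v i * \<psi> w \<gamma>))"
      by (rule poly_mapping_eqI)
         (simp add: lookup_add lookup_minus lookup_sum lookup_single right_diff_distrib sum_subtractf
           sum_distrib_left when_def if_distrib[of "\<lambda>z. _ * z"] cong: if_cong)
    also have "(\<Sum>i\<in>B. \<Sum>\<gamma>\<in>W. ?s (b i) (t \<gamma>) (\<phi> v i * \<psi> w \<gamma>)) =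
      (\<Sum>c\<in>W \<times> B. Poly_Mapping.single (case c of (\<gamma>, i) \<Rightarrow> (b i, t \<gamma>)) (?g s c))"
      by (subst sum.swap) (simp add: sum.cartesian_product pair_coord_def s case_prod_unfold)
    finally show "Poly_Mapping.single s 1 - (\<Sum>c\<in>W \<times> B. Poly_Mapping.single
        (case c of (\<gamma>, i) \<Rightarrow> (b i, t \<gamma>)) (?g s c)) \<in> ?N"
      by (simp add: s)
  qed
qed

lemma coord_space_cong:
  assumes "coord_space V \<phi> C b"
    and "carrier V' = carrier V" "zero V' = zero V" "add V' = add V" "smult V' = smult V"
  shows "coord_space V' \<phi> C b"
  using assms(1) unfolding coord_space_def assms(2-) by blast

lemma lie_tensor_simps:
  "carrier (lie_tensor L A) = carrier (tensor_product L A)"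
  "zero (lie_tensor L A) = zero (tensor_product L A)"
  "add (lie_tensor L A) = add (tensor_product L A)"
  "smult (lie_tensor L A) = smult (tensor_product L A)"
  "bracket (lie_tensor L A) = (\<lambda>X Y. \<Union>p\<in>X. \<Union>q\<in>Y.
     tensor_kernel L A +>\<^bsub>free_module (carrier L \<times> carrier A)\<^esub> free_bracket L A p q)"
  by (simp_all add: lie_tensor_def module.defs lie_alg.defs tensor_product_def quotient_module_def)

definition tensor_coord :: "('v \<Rightarrow> 'i \<Rightarrow> 'k::field) \<Rightarrow> ('w \<Rightarrow> 'j \<Rightarrow> 'k) \<Rightarrow> ('v \<times> 'w \<Rightarrow>\<^sub>0 'k) set \<Rightarrow> 'j \<times> 'i \<Rightarrow> 'k" where
  "tensor_coord \<phi> \<psi> = finsupp_quotient.coord (pair_coord \<phi> \<psi>)"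

definition pure_tensor where
  "pure_tensor V U v w =
    tensor_kernel V U +>\<^bsub>free_module (carrier V \<times> carrier U)\<^esub> Poly_Mapping.single (v, w) 1"

text \<open>The coordinates of a bracket of representatives depend only on the coordinates of the
  representatives, and bilinearly so, because this holds for the bracket and for the multiplication
  separately. The structure constants are the products of the two families of structure constants.\<close>

lemma lie_tensor_coords:
  fixes L :: "('k::field, 'g, 'm) lie_alg_scheme" and A :: "('k, 'a, 'n) module_scheme"
  assumes L: "coord_space L \<phi> B b" and A: "coord_space A \<psi> W t"
    and brL: "coord_space.bilinear_op L \<phi> B b (bracket L)"
    and multA: "coord_space.bilinear_op A \<psi> W t (mult A)"
  defines "T \<equiv> lie_tensor L A" and "\<theta> \<equiv> tensor_coord \<phi> \<psi>"
    and "u \<equiv> \<lambda>(\<gamma>, i). pure_tensor L A (b i) (t \<gamma>)"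
  shows "coord_space T \<theta> (W \<times> B) u"
    and "coord_space.bilinear_op T \<theta> (W \<times> B) u (bracket T)"
    and "i \<in> B \<Longrightarrow> j \<in> B \<Longrightarrow> \<alpha> \<in> W \<Longrightarrow> \<beta> \<in> W \<Longrightarrow>
      \<theta> (bracket T (u (\<alpha>, i)) (u (\<beta>, j))) (\<gamma>, k) = \<phi> (bracket L (b i) (b j)) k * \<psi> (t \<alpha> \<otimes>\<^bsub>A\<^esub> t \<beta>) \<gamma>"
    and "X \<in> carrier T \<Longrightarrow> f \<in> linear_forms class_ring L \<Longrightarrow> (\<And>a. a \<in> carrier A \<Longrightarrow> e a = \<psi> a \<gamma>) \<Longrightarrow>
      tensor_form f e X = (\<Sum>i\<in>B. \<theta> X (\<gamma>, i) * f (b i))"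
proof -
  let ?S = "carrier L \<times> carrier A"
  let ?M = "free_module ?S :: ('k, 'g \<times> 'a \<Rightarrow>\<^sub>0 'k) module"
  let ?g = "pair_coord \<phi> \<psi>"
  interpret L: coord_space L \<phi> B b by fact
  interpret A: coord_space A \<psi> W t by fact
  interpret finsupp_quotient ?M ?S ?g "tensor_relations L A" "W \<times> B" "\<lambda>(\<gamma>, i). (b i, t \<gamma>)"
    by (rule finsupp_quotient_tensor[OF L A])
  have N: "tensor_kernel L A = N" by (simp add: tensor_kernel_def)
  have Q: "tensor_product L A = Q" by (simp add: tensor_product_def N)
  have u: "u = (\<lambda>c. cls (Poly_Mapping.single (case c of (\<gamma>, i) \<Rightarrow> (b i, t \<gamma>)) 1))"
    by (auto simp: u_def fun_eq_iff pure_tensor_def N)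
  have \<theta>: "\<theta> = coord" by (simp add: \<theta>_def tensor_coord_def)
  have T: "carrier T = carrier Q" by (simp add: T_def lie_tensor_simps Q)
  show cs: "coord_space T \<theta> (W \<times> B) u"
    by (rule coord_space_cong[OF coord_space_Q[folded u \<theta>]]) (simp_all add: T_def lie_tensor_simps Q)
  interpret T: coord_space T \<theta> "W \<times> B" u by (rule cs)
  have br: "bracket L x y \<in> carrier L" if "x \<in> carrier L" "y \<in> carrier L" for x y
    using brL that by (simp add: L.bilinear_op_def)
  have mu: "x \<otimes>\<^bsub>A\<^esub> y \<in> carrier A" if "x \<in> carrier A" "y \<in> carrier A" for x y
    using multA that by (simp add: A.bilinear_op_def)
  have fb_closed: "free_bracket L A p q \<in> carrier ?M" if "p \<in> carrier ?M" "q \<in> carrier ?M" for p q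
  proof -
    have sum_closed: "(\<Sum>s\<in>I. h s) \<in> carrier ?M" if "\<And>s. s \<in> I \<Longrightarrow> h s \<in> carrier ?M" for I :: "('g \<times> 'a) set" and h
      using that by (induction I rule: infinite_finite_induct) (auto simp: M_zero_closed M_add_closed)
    show ?thesis
      unfolding free_bracket_def case_prod_unfold
    proof (intro sum_closed M_single_closed)
      fix s s' assume "s \<in> Poly_Mapping.keys p" "s' \<in> Poly_Mapping.keys q"
      then have "s \<in> ?S" "s' \<in> ?S" using that by (auto simp: M_carrier)
      then show "(bracket L (fst s) (fst s'), snd s \<otimes>\<^bsub>A\<^esub> snd s') \<in> ?S"
        by (auto intro: br mu)
    qed
  qed
  define K where "K = (\<lambda>d e c. case d of (\<alpha>, i) \<Rightarrow> case e of (\<beta>, j) \<Rightarrow> case c of (\<gamma>, k) \<Rightarrow>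
    \<phi> (bracket L (b i) (b j)) k * \<psi> (t \<alpha> \<otimes>\<^bsub>A\<^esub> t \<beta>) \<gamma>)"
  have pair: "?g (bracket L x y, a \<otimes>\<^bsub>A\<^esub> a') c = (\<Sum>d\<in>W \<times> B. \<Sum>e\<in>W \<times> B. ?g (x, a) d * ?g (y, a') e * K d e c)"
    if "x \<in> carrier L" "y \<in> carrier L" "a \<in> carrier A" "a' \<in> carrier A" for x y a a' c
  proof -
    obtain \<gamma> k where c: "c = (\<gamma>, k)" by (cases c)
    have "?g (bracket L x y, a \<otimes>\<^bsub>A\<^esub> a') c =
      (\<Sum>i\<in>B. \<Sum>j\<in>B. \<phi> x i * \<phi> y j * \<phi> (bracket L (b i) (b j)) k) *
      (\<Sum>\<alpha>\<in>W. \<Sum>\<beta>\<in>W. \<psi> a \<alpha> * \<psi> a' \<beta> * \<psi> (t \<alpha> \<otimes>\<^bsub>A\<^esub> t \<beta>) \<gamma>)"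
      using brL multA that by (simp add: c pair_coord_def L.bilinear_op_def A.bilinear_op_def)
    also have "\<dots> = (\<Sum>\<alpha>\<in>W. \<Sum>i\<in>B. \<Sum>\<beta>\<in>W. \<Sum>j\<in>B.
       (\<phi> x i * \<phi> y j * \<phi> (bracket L (b i) (b j)) k) * (\<psi> a \<alpha> * \<psi> a' \<beta> * \<psi> (t \<alpha> \<otimes>\<^bsub>A\<^esub> t \<beta>) \<gamma>))"
      by (simp add: sum_product sum.swap[of _ W B])
    also have "\<dots> = (\<Sum>d\<in>W \<times> B. \<Sum>e\<in>W \<times> B. ?g (x, a) d * ?g (y, a') e * K d e c)"
      by (simp add: sum.cartesian_product' pair_coord_def K_def c algebra_simps)
    finally show ?thesis .
  qed
  have fb: "weighted_sum ?g (free_bracket L A p q) c =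
      (\<Sum>d\<in>W \<times> B. \<Sum>e\<in>W \<times> B. weighted_sum ?g p d * weighted_sum ?g q e * K d e c)"
    if p: "p \<in> carrier ?M" and q: "q \<in> carrier ?M" for p q c
  proof -
    let ?p = "Poly_Mapping.lookup p" and ?q = "Poly_Mapping.lookup q"
    let ?P = "Poly_Mapping.keys p" and ?Q = "Poly_Mapping.keys q"
    have "weighted_sum ?g (free_bracket L A p q) c = (\<Sum>s\<in>?P. \<Sum>s'\<in>?Q. ?p s * ?q s' *
        (\<Sum>d\<in>W \<times> B. \<Sum>e\<in>W \<times> B. ?g s d * ?g s' e * K d e c))"
      unfolding free_bracket_def weighted_sum_sum case_prod_unfold weighted_sum_single
      using p q by (intro sum.cong refl) (auto simp: M_carrier pair dest!: subsetD)
    also have "\<dots> = (\<Sum>s\<in>?P. \<Sum>s'\<in>?Q. \<Sum>d\<in>W \<times> B. \<Sum>e\<in>W \<times> B. (?p s * ?g s d) * (?q s' * ?g s' e) * K d e c)"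
      by (simp add: sum_distrib_left algebra_simps)
    also have "\<dots> = (\<Sum>d\<in>W \<times> B. \<Sum>e\<in>W \<times> B. \<Sum>s\<in>?P. \<Sum>s'\<in>?Q. (?p s * ?g s d) * (?q s' * ?g s' e) * K d e c)"
      by (simp add: sum.swap[of _ "W \<times> B" ?P] sum.swap[of _ "W \<times> B" ?Q])
    also have "\<dots> = (\<Sum>d\<in>W \<times> B. \<Sum>e\<in>W \<times> B. weighted_sum ?g p d * weighted_sum ?g q e * K d e c)"
      unfolding weighted_sum_def sum_product by (simp only: sum_distrib_right)
    finally show ?thesis .
  qed
  have brT: "bracket T (cls p) (cls q) = cls (free_bracket L A p q)"
    if "p \<in> carrier ?M" "q \<in> carrier ?M" for p q
  proof -
    have "cls (free_bracket L A x y) = cls (free_bracket L A p q)" if "x \<in> cls p" "y \<in> cls q" for x y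
      using that \<open>p \<in> carrier ?M\<close> \<open>q \<in> carrier ?M\<close>
      by (intro cls_eqI fb_closed) (auto simp: cls_eq fb)
    moreover have "p \<in> cls p" "q \<in> cls q" using that by (auto simp: cls_eq)
    ultimately have "(\<Union>x\<in>cls p. \<Union>y\<in>cls q. cls (free_bracket L A x y)) = cls (free_bracket L A p q)"
      by (intro equalityI subsetI) blast+
    then show ?thesis by (simp add: T_def lie_tensor_simps N)
  qed
  have formula: "bracket T X Y \<in> carrier T"
    "\<theta> (bracket T X Y) c = (\<Sum>d\<in>W \<times> B. \<Sum>e\<in>W \<times> B. \<theta> X d * \<theta> Y e * K d e c)"
    if XY: "X \<in> carrier T" "Y \<in> carrier T" for X Y c
  proof -
    obtain p q where pq: "p \<in> carrier ?M" "X = cls p" "q \<in> carrier ?M" "Y = cls q"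
      using XY by (auto simp: T Q_carrier)
    then show "bracket T X Y \<in> carrier T"
      "\<theta> (bracket T X Y) c = (\<Sum>d\<in>W \<times> B. \<Sum>e\<in>W \<times> B. \<theta> X d * \<theta> Y e * K d e c)"
      using fb_closed[OF pq(1,3)] by (auto simp: brT T Q_carrier \<theta> coord_cls fb)
  qed
  have basis: "\<theta> (bracket T (u d) (u e)) c = K d e c" if "d \<in> W \<times> B" "e \<in> W \<times> B" for d e c
    using formula(2)[OF T.b(1)[OF that(1)] T.b(1)[OF that(2)], of c]
      T.sum_coords_basis[OF that(1), of "\<lambda>d. \<Sum>e'\<in>W \<times> B. \<theta> (u e) e' * K d e' c"]
      T.sum_coords_basis[OF that(2), of "\<lambda>e'. K d e' c"]
    by (simp only: sum_distrib_left mult.assoc)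
  then show "\<theta> (bracket T (u (\<alpha>, i)) (u (\<beta>, j))) (\<gamma>, k) = \<phi> (bracket L (b i) (b j)) k * \<psi> (t \<alpha> \<otimes>\<^bsub>A\<^esub> t \<beta>) \<gamma>"
    if "i \<in> B" "j \<in> B" "\<alpha> \<in> W" "\<beta> \<in> W"
    using that by (simp add: K_def)
  show "T.bilinear_op (bracket T)"
    unfolding T.bilinear_op_def
  proof (intro ballI conjI allI formula(1))
    fix X Y c assume XY: "X \<in> carrier T" "Y \<in> carrier T"
    show "\<theta> (bracket T X Y) c =
        (\<Sum>d\<in>W \<times> B. \<Sum>e\<in>W \<times> B. \<theta> X d * \<theta> Y e * \<theta> (bracket T (u d) (u e)) c)"
      unfolding formula(2)[OF XY] by (intro sum.cong refl) (simp add: basis)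
  qed
  show "tensor_form f e X = (\<Sum>i\<in>B. \<theta> X (\<gamma>, i) * f (b i))"
    if X: "X \<in> carrier T" and f: "f \<in> linear_forms class_ring L" and e: "\<And>a. a \<in> carrier A \<Longrightarrow> e a = \<psi> a \<gamma>"
  proof -
    obtain p where p: "p \<in> carrier ?M" "X = cls p" using X by (auto simp: T Q_carrier)
    have val: "(\<Sum>(v, w)\<in>Poly_Mapping.keys q. Poly_Mapping.lookup q (v, w) * (f v * e w)) =
        (\<Sum>i\<in>B. \<theta> X (\<gamma>, i) * f (b i))" if q: "q \<in> X" for q
    proof -
      have "\<theta> X = weighted_sum ?g p" using p by (simp add: \<theta> coord_cls)
      then have qM: "q \<in> carrier ?M" "weighted_sum ?g q = \<theta> X" using q p by (auto simp: cls_eq)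
      have "(\<Sum>(v, w)\<in>Poly_Mapping.keys q. Poly_Mapping.lookup q (v, w) * (f v * e w)) =
        (\<Sum>s\<in>Poly_Mapping.keys q. \<Sum>i\<in>B. Poly_Mapping.lookup q s * ?g s (\<gamma>, i) * f (b i))"
      proof (rule sum.cong[OF refl])
        fix s assume "s \<in> Poly_Mapping.keys q"
        then obtain v w where s: "s = (v, w)" "v \<in> carrier L" "w \<in> carrier A"
          using qM(1) by (auto simp: M_carrier)
        show "(case s of (v, w) \<Rightarrow> Poly_Mapping.lookup q (v, w) * (f v * e w)) =
          (\<Sum>i\<in>B. Poly_Mapping.lookup q s * ?g s (\<gamma>, i) * f (b i))"
          using L.linear_form_expand[OF f s(2)] e[OF s(3)]
          by (simp add: s pair_coord_def sum_distrib_left sum_distrib_right algebra_simps)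
      qed
      also have "\<dots> = (\<Sum>i\<in>B. weighted_sum ?g q (\<gamma>, i) * f (b i))"
        by (subst sum.swap) (simp add: weighted_sum_def sum_distrib_right)
      finally show ?thesis by (simp add: qM)
    qed
    have "p \<in> X" using p by (simp add: cls_eq)
    then show ?thesis
      unfolding tensor_form_def using val by (intro the_equality) auto
  qed
qed

section \<open>The index and the regular forms of the tensor product\<close>

lemma bilinear_op_bracket:
  assumes "lie_algebra class_ring L" "coord_space L \<phi> B b"
  shows "coord_space.bilinear_op L \<phi> B b (bracket L)"
proof -
  interpret lie_algebra class_ring L by fact
  interpret coord_space L \<phi> B b by fact
  show ?thesis
    by (rule bilinear_opI)
       (auto simp: linear_forms_iff bracket_closed bracket_add_left bracket_add_right
         bracket_smult_left bracket_smult_right add smult)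
qed

lemma nullity_cong:
  assumes "finite C" "\<And>r c. r \<in> C \<Longrightarrow> c \<in> C \<Longrightarrow> N r c = N' r c"
  shows "nullity C N = nullity C N'"
  using assms by (intro nullity_reindex[OF _ bij_betw_id]) auto

lemma exponents_le_iff: "\<mu> \<in> exponents l \<Longrightarrow> \<omega> \<in> exponents_le l \<mu> \<longleftrightarrow> exp_le \<omega> \<mu>"
proof -
  assume \<mu>: "\<mu> \<in> exponents l"
  have "\<omega> \<in> exponents l" if "exp_le \<omega> \<mu>"
  proof -
    have "Poly_Mapping.keys \<omega> \<subseteq> Poly_Mapping.keys \<mu>"
    proof
      fix i assume "i \<in> Poly_Mapping.keys \<omega>"
      moreover have "Poly_Mapping.lookup \<omega> i \<le> Poly_Mapping.lookup \<mu> i"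
        using that by (simp add: exp_le_def)
      ultimately show "i \<in> Poly_Mapping.keys \<mu>" by (simp add: in_keys_iff)
    qed
    then show ?thesis using \<mu> by (auto simp: exponents_def)
  qed
  then show ?thesis by (auto simp: exponents_le_def)
qed

lemma lin_mats_forms:
  "lin_mats {\<lambda>j k. f (bracket L j k) | f. f \<in> linear_forms class_ring (L :: ('k::field, 'g, 'n) lie_alg_scheme)}"
  (is "lin_mats ?\<M>")
proof -
  let ?F = "linear_forms class_ring L"
  have mem: "(\<lambda>j k. f (bracket L j k)) \<in> ?\<M>" if "f \<in> ?F" for f using that by blast
  have "(\<lambda>_. 0) \<in> ?F" by (simp add: linear_forms_iff)
  then have "(\<lambda>_ _. 0) \<in> ?\<M>" by (rule mem)
  moreover have "(\<lambda>r c. M r c + N r c) \<in> ?\<M>" if MN: "M \<in> ?\<M>" "N \<in> ?\<M>" for M N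
  proof -
    obtain f g where fg: "f \<in> ?F" "g \<in> ?F" "M = (\<lambda>j k. f (bracket L j k))" "N = (\<lambda>j k. g (bracket L j k))"
      using MN by blast
    then have "(\<lambda>x. f x + g x) \<in> ?F" by (auto simp: linear_forms_iff algebra_simps)
    from mem[OF this] show ?thesis by (simp add: fg)
  qed
  moreover have "(\<lambda>r c. M r c * a) \<in> ?\<M>" if M: "M \<in> ?\<M>" for M a
  proof -
    obtain f where f: "f \<in> ?F" "M = (\<lambda>j k. f (bracket L j k))" using M by blast
    then have "(\<lambda>x. f x * a) \<in> ?F" by (auto simp: linear_forms_iff algebra_simps)
    from mem[OF this] show ?thesis by (simp add: f)
  qed
  ultimately show ?thesis by (simp add: lin_mats_def)
qed

text \<open>The stabilizer of a form on the tensor product is the kernel of the block matrix built from its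
  components, so the bounds on the nullity apply with \<open>k\<close> the index. A form given as a function on the
  tensor product has as components its restrictions to the slices \<open>L \<otimes> \<tau>\<^sup>\<omega>\<close>.\<close>

theorem proposition4p1:
  fixes L :: "('k::field_char_0, 'g) lie_alg" and l :: nat and \<mu> :: "nat \<Rightarrow>\<^sub>0 nat"
  assumes "lie_algebra class_ring L"
    and "vectorspace.fin_dim class_ring L"
    and "\<mu> \<in> exponents l"
  shows "lie_index class_ring (lie_tensor L (truncated_algebra l \<mu>)) =
           lie_index class_ring L *
           vectorspace.dim class_ring (truncated_algebra l \<mu> :: ('k, 'k mpoly set) module)
         \<and> (\<forall>f :: (nat \<Rightarrow>\<^sub>0 nat) \<Rightarrow> 'g \<Rightarrow> 'k.
           (\<forall>\<omega> \<in> exponents_le l \<mu>. f \<omega> \<in> linear_forms class_ring L) \<longrightarrow>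
           (regular_form class_ring (lie_tensor L (truncated_algebra l \<mu>))
              (\<lambda>X. \<Sum>\<omega> \<in> exponents_le l \<mu>. tensor_form (f \<omega>) (eps l \<mu> \<omega>) X)
            \<longleftrightarrow> regular_form class_ring L (f \<mu>)))"
proof -
  let ?W = "exponents_le l \<mu>"
  let ?A = "truncated_algebra l \<mu> :: ('k, 'k mpoly set) module"
  let ?T = "lie_tensor L ?A"
  let ?F = "linear_forms class_ring L" and ?FT = "linear_forms class_ring ?T"
  have "vectorspace class_ring L" using assms(1) by (simp add: lie_algebra_def)
  then obtain \<phi> and B :: "'g set" where L: "coord_space L \<phi> B (\<lambda>v. v)"
    using ex_coord_space assms(2) by blast
  define \<psi> where "\<psi> = (trunc_coord l \<mu> :: 'k mpoly set \<Rightarrow> _)"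
  define \<theta> where "\<theta> = tensor_coord \<phi> \<psi>"
  define u where "u = (\<lambda>(\<gamma>, i). pure_tensor L ?A i (tau l \<mu> \<gamma>))"
  note brL = bilinear_op_bracket[OF assms(1) L]
  note A = truncated_algebra_coords[OF assms(3), where ?'k = 'k, folded \<psi>_def]
  note T = lie_tensor_coords[OF L A(1) brL A(2), folded \<theta>_def u_def]
  interpret L: coord_space L \<phi> B "\<lambda>v. v" by (rule L)
  interpret A: coord_space ?A \<psi> ?W "tau l \<mu>" by (rule A(1))
  interpret T: coord_space ?T \<theta> "?W \<times> B" u by (rule T(1))
  have \<mu>W: "\<mu> \<in> ?W" using assms(3) by (simp add: exponents_le_def exp_le_def)
  have br: "bracket L i j \<in> carrier L" if "i \<in> B" "j \<in> B" for i j
    using brL L.b that by (auto simp: L.bilinear_op_def)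
  define n where "n = (\<lambda>f :: 'g \<Rightarrow> 'k. nullity B (\<lambda>j k. f (bracket L j k)))"
  have stabL: "stabilizer_dim class_ring L f = n f" if "f \<in> ?F" for f
    unfolding n_def by (rule stabilizer_dim_eq_nullity[OF L brL that])
  define k where "k = lie_index class_ring L"
  have k: "k = Inf {n f | f. f \<in> ?F}"
    unfolding k_def lie_index_def using stabL by (metis (mono_tags, lifting))
  have zeroF: "(\<lambda>_. 0) \<in> ?F" by (simp add: linear_forms_iff)
  have k_le: "k \<le> n f" if "f \<in> ?F" for f
    unfolding k using that by (intro cInf_lower) auto
  have "k \<in> {n f | f. f \<in> ?F}" unfolding k by (rule Inf_nat_def1) (use zeroF in blast)
  then obtain f0 where f0: "f0 \<in> ?F" "n f0 = k" by blast

  \<comment> \<open>the two bounds for the block matrix, read as bounds for a form \<open>F\<close> with components \<open>f \<omega>\<close>\<close>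
  have key: "stabilizer_dim class_ring ?T F \<le> card ?W * n (f \<mu>)"
    "card ?W * k + n (f \<mu>) \<le> stabilizer_dim class_ring ?T F + k"
    if F: "F \<in> ?FT" and f: "\<And>\<omega>. \<omega> \<in> ?W \<Longrightarrow> f \<omega> \<in> ?F"
      and Ff: "\<And>\<omega> i. \<omega> \<in> ?W \<Longrightarrow> i \<in> B \<Longrightarrow> F (u (\<omega>, i)) = f \<omega> i" for F f
  proof -
    \<comment> \<open>outside \<open>W\<close> nothing is known about \<open>f\<close>; the zero matrix keeps \<open>N\<close> inside the linear space\<close>
    define N where "N = (\<lambda>\<omega>. if \<omega> \<in> ?W then (\<lambda>j k. f \<omega> (bracket L j k)) else (\<lambda>_ _. 0))"
    have N: "N \<omega> \<in> {\<lambda>j k. f (bracket L j k) | f. f \<in> ?F}" for \<omega>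
      using f[of \<omega>] zeroF by (auto simp: N_def)
    have "F (bracket ?T (u (\<alpha>, i)) (u (\<beta>, j))) = multi_block \<mu> N (\<alpha>, i) (\<beta>, j)"
      if "\<alpha> \<in> ?W" "\<beta> \<in> ?W" "i \<in> B" "j \<in> B" for \<alpha> \<beta> i j
    proof -
      have "bracket ?T (u (\<alpha>, i)) (u (\<beta>, j)) \<in> carrier ?T"
        using T(2) T.b that by (auto simp: T.bilinear_op_def)
      then have "F (bracket ?T (u (\<alpha>, i)) (u (\<beta>, j))) = (\<Sum>c\<in>?W \<times> B. \<theta> (bracket ?T (u (\<alpha>, i)) (u (\<beta>, j))) c * F (u c))"
        by (rule T.linear_form_expand[OF F])
      also have "\<dots> = (\<Sum>\<gamma>\<in>?W. \<Sum>m\<in>B. (if \<gamma> = \<alpha> + \<beta> then \<phi> (bracket L i j) m * f \<gamma> m else 0))"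
        unfolding sum.cartesian_product
        by (intro sum.cong refl) (auto simp: T(3)[OF that(3,4,1,2)] A(3)[OF that(1,2)] Ff)
      also have "\<dots> = (\<Sum>\<gamma>\<in>?W. if \<gamma> = \<alpha> + \<beta> then f \<gamma> (bracket L i j) else 0)"
        using L.linear_form_expand[OF f br[OF that(3,4)]] by (intro sum.cong refl) auto
      also have "\<dots> = multi_block \<mu> N (\<alpha>, i) (\<beta>, j)"
        using A.finC by (auto simp: multi_block_def N_def exponents_le_iff[OF assms(3)])
      finally show ?thesis .
    qed
    then have "stabilizer_dim class_ring ?T F = nullity (?W \<times> B) (multi_block \<mu> N)"
      unfolding stabilizer_dim_eq_nullity[OF T(1,2) F] by (intro nullity_cong[OF T.finC]) auto
    moreover have "nullity B (N \<mu>) = n (f \<mu>)" by (simp add: N_def n_def \<mu>W)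
    moreover have "k \<le> nullity B M" if "M \<in> {\<lambda>j k. f (bracket L j k) | f. f \<in> ?F}" for M
      using that k_le by (auto simp: n_def)
    then have "nullity (?W \<times> B) (multi_block \<mu> N) \<le> card ?W * nullity B (N \<mu>) \<and>
        card ?W * k + nullity B (N \<mu>) \<le> nullity (?W \<times> B) (multi_block \<mu> N) + k"
      by (intro nullity_multi_block[OF L.finC lin_mats_forms _ assms(3) N])
    ultimately show "stabilizer_dim class_ring ?T F \<le> card ?W * n (f \<mu>)"
      "card ?W * k + n (f \<mu>) \<le> stabilizer_dim class_ring ?T F + k"
      by simp_all
  qed

  have lower: "card ?W * k \<le> stabilizer_dim class_ring ?T F" if F: "F \<in> ?FT" for F
  proof -
    define f where "f = (\<lambda>\<omega> x. \<Sum>i\<in>B. \<phi> x i * F (u (\<omega>, i)))"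
    have f: "f \<omega> \<in> ?F" for \<omega>
      unfolding f_def by (rule L.linear_form_of_values)
    have "F (u (\<omega>, i)) = f \<omega> i" if "i \<in> B" for \<omega> i
      using L.sum_coords_basis[OF that] by (simp add: f_def)
    then show ?thesis using key(2)[OF F f] k_le[OF f, of \<mu>] by fastforce
  qed

  have tensor: "(\<lambda>X. \<Sum>\<omega>\<in>?W. tensor_form (f \<omega>) (eps l \<mu> \<omega>) X) \<in> ?FT"
    "\<And>\<omega> i. \<omega> \<in> ?W \<Longrightarrow> i \<in> B \<Longrightarrow> (\<Sum>\<omega>'\<in>?W. tensor_form (f \<omega>') (eps l \<mu> \<omega>') (u (\<omega>, i))) = f \<omega> i"
    if f: "\<forall>\<omega>\<in>?W. f \<omega> \<in> ?F" for f
  proof -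
    let ?G = "\<lambda>X. \<Sum>c\<in>?W \<times> B. \<theta> X c * (case c of (\<omega>, i) \<Rightarrow> f \<omega> i)"
    have eq: "(\<Sum>\<omega>\<in>?W. tensor_form (f \<omega>) (eps l \<mu> \<omega>) X) = ?G X" if X: "X \<in> carrier ?T" for X
    proof -
      have "(\<Sum>\<omega>\<in>?W. tensor_form (f \<omega>) (eps l \<mu> \<omega>) X) = (\<Sum>\<omega>\<in>?W. \<Sum>i\<in>B. \<theta> X (\<omega>, i) * f \<omega> i)"
        using f A.dual_basis_form_eq by (intro sum.cong refl T(4)[OF X]) (auto simp: eps_def)
      then show ?thesis by (simp add: sum.cartesian_product case_prod_unfold)
    qed
    have "?G \<in> ?FT" by (rule T.linear_form_of_values)
    then show "(\<lambda>X. \<Sum>\<omega>\<in>?W. tensor_form (f \<omega>) (eps l \<mu> \<omega>) X) \<in> ?FT"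
      using eq T.add T.smult by (simp add: linear_forms_iff)
    show "(\<Sum>\<omega>'\<in>?W. tensor_form (f \<omega>') (eps l \<mu> \<omega>') (u (\<omega>, i))) = f \<omega> i" if "\<omega> \<in> ?W" "i \<in> B" for \<omega> i
      using that eq[OF T.b(1), of "(\<omega>, i)"] T.sum_coords_basis[of "(\<omega>, i)" "\<lambda>(\<omega>, i). f \<omega> i"]
      by simp
  qed

  have index: "lie_index class_ring ?T = card ?W * k"
  proof (rule antisym)
    \<comment> \<open>any form whose component at \<open>\<mu>\<close> is regular attains the minimum; here all components are \<open>f0\<close>\<close>
    let ?F0 = "\<lambda>X. \<Sum>\<omega>\<in>?W. tensor_form f0 (eps l \<mu> \<omega>) X"
    note F0 = tensor[of "\<lambda>_. f0"]
    have "stabilizer_dim class_ring ?T ?F0 \<le> card ?W * k"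
      using key(1)[of ?F0 "\<lambda>_. f0"] F0 f0 by simp
    moreover have "lie_index class_ring ?T \<le> stabilizer_dim class_ring ?T ?F0"
      unfolding lie_index_def using F0(1) f0 by (intro cInf_lower) auto
    ultimately show "lie_index class_ring ?T \<le> card ?W * k" by linarith
    show "card ?W * k \<le> lie_index class_ring ?T"
      unfolding lie_index_def using F0(1) f0 lower by (intro cInf_greatest) auto
  qed

  have regular: "regular_form class_ring ?T (\<lambda>X. \<Sum>\<omega>\<in>?W. tensor_form (f \<omega>) (eps l \<mu> \<omega>) X)
      \<longleftrightarrow> regular_form class_ring L (f \<mu>)"
    if f: "\<forall>\<omega>\<in>?W. f \<omega> \<in> ?F" for f
  proof -
    let ?G = "\<lambda>X. \<Sum>\<omega>\<in>?W. tensor_form (f \<omega>) (eps l \<mu> \<omega>) X"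
    note t = tensor[OF f]
    have s: "stabilizer_dim class_ring ?T ?G \<le> card ?W * n (f \<mu>)"
      "card ?W * k + n (f \<mu>) \<le> stabilizer_dim class_ring ?T ?G + k"
      using key[OF t(1), of f] f t(2) by auto
    have "f \<mu> \<in> ?F" using f \<mu>W by blast
    have "stabilizer_dim class_ring ?T ?G = card ?W * k \<longleftrightarrow> n (f \<mu>) = k"
      using s k_le[OF \<open>f \<mu> \<in> ?F\<close>] by auto
    then show ?thesis
      using t(1) \<open>f \<mu> \<in> ?F\<close> stabL by (simp add: regular_form_def index k_def)
  qed
  show ?thesis
    using index regular by (simp add: A.dim_eq_card k_def mult.commute)
qed

end
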